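(* Let $M$ be a connected differentiable manifold with a Riemannian metric $\alpha$, let $\beta$ be a one-form on $M$ whose dual vector field $\beta^{\sharp}$ satisfies $\alpha(\beta^{\sharp},\beta^{\sharp})<1$ at every point, and let $F(v)=\sqrt{\alpha(v,v)}+\beta(v)$ be the corresponding Randers metric, assumed to be non-Riemannian (i.e. $\beta$ is not identically zero). Let $\nabla^*$ be the Lévi-Civita connection of $\alpha$. Then $F$ admits a compatible linear connection if and only if $\beta^{\sharp}$ is of constant Riemannian length $K\neq 0$, i.e. $\alpha(\beta^{\sharp},\beta^{\sharp})=K^2$ for a constant $K> 0$. In this case, the pointwise solution of the optimization problem $$\min\ |\iota_X A|^2 \quad\text{subject to}\quad \alpha(A(X,Y),Z)=-\alpha(A(X,Z),Y)\ \text{ for all } Y,Z \quad\text{and}\quad A(X,\beta^{\sharp})=-\nabla^*_X\beta^{\sharp}$$ (for every vector field $X$) gives the difference tensor $$A(X,Y)=\frac{\alpha(\nabla^*_X\beta^{\sharp},Y)}{K^2}\,\beta^{\sharp}-\frac{\alpha(Y,\beta^{\sharp})}{K^2}\,\nabla^*_X\beta^{\sharp},$$ and $\nabla^{\circ}_XY=\nabla^*_XY+A(X,Y)$ is a linear connection compatible with the Randers metric $F$.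
   Context: All objects are smooth. The dual vector field $\beta^{\sharp}$ is defined by $\alpha(\beta^{\sharp},Y)=\beta(Y)$ for all $Y$. A linear connection $\nabla$ on $M$ is compatible with $F\colon TM\to\mathbb{R}$ if the parallel transports with respect to $\nabla$ preserve the Randers norm $F$ of tangent vectors. In the optimization problem, the unknown $A$ is a tensor of type $(1,2)$, and $\iota_XA(Y):=A(X,Y)$. The norm $|\cdot|$ of tensors at a point $p\in M$ is the one induced by $\alpha$: with respect to an $\alpha$-orthonormal basis $e_1,\dots,e_n$ of $T_pM$ and its dual basis $\theta^1,\dots,\theta^n$, the tensors $e_{i_1}\otimes\cdots\otimes e_{i_k}\otimes\theta^{j_1}\otimes\cdots\otimes\theta^{j_l}$ form an orthonormal basis. In particular, $|\iota_XA|^2$ at $p$ is the sum of the squares of the matrix entries of the endomorphism $\iota_XA\colon T_pM\to T_pM$ in an orthonormal basis. "Pointwise solution" means that at each $p\in M$ the constraints hold and $|\iota_XA|^2$ at $p$ is minimal among all $A$ at $p$ satisfying the constraints. *)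

theory Defs
  imports "HOL-Analysis.Analysis" "HOL-Library.Function_Algebras"
begin

section \<open>Preliminaries\<close>

instantiation "fun" :: (type, real_vector) real_vector
begin

definition scaleR_fun :: "real \<Rightarrow> ('a \<Rightarrow> 'b) \<Rightarrow> 'a \<Rightarrow> 'b"
  where "scaleR_fun r f = (\<lambda>x. r *\<^sub>R f x)"

instance
  by standard (simp_all add: scaleR_fun_def plus_fun_def scaleR_add_left scaleR_add_right)

end

text \<open>Smoothness, for maps on an open subset \<open>S\<close> of a finite-dimensional space.  There, \<open>f\<close> is of
  class \<open>C\<^sup>k\<^sup>+\<^sup>1\<close> iff it is differentiable and all its directional derivatives are of class \<open>C\<^sup>k\<close>.\<close>

primrec Ck_on :: "nat \<Rightarrow> 'a::euclidean_space set \<Rightarrow> ('a \<Rightarrow> 'b::real_normed_vector) \<Rightarrow> bool" where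
  "Ck_on 0 S f \<longleftrightarrow> continuous_on S f"
| "Ck_on (Suc k) S f \<longleftrightarrow> (\<forall>x\<in>S. f differentiable (at x)) \<and>
     (\<forall>v. Ck_on k S (\<lambda>x. frechet_derivative f (at x) v))"

definition smooth_on :: "'a::euclidean_space set \<Rightarrow> ('a \<Rightarrow> 'b::real_normed_vector) \<Rightarrow> bool"
  where "smooth_on S f \<longleftrightarrow> (\<forall>k. Ck_on k S f)"

definition linear_on :: "'a::real_vector set \<Rightarrow> ('a \<Rightarrow> 'b::real_vector) \<Rightarrow> bool"
  where "linear_on T f \<longleftrightarrow>
    (\<forall>x\<in>T. \<forall>y\<in>T. f (x + y) = f x + f y) \<and> (\<forall>r. \<forall>x\<in>T. f (r *\<^sub>R x) = r *\<^sub>R f x)"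

definition bilinear_on :: "'a::real_vector set \<Rightarrow> ('a \<Rightarrow> 'a \<Rightarrow> 'b::real_vector) \<Rightarrow> bool"
  where "bilinear_on T f \<longleftrightarrow>
    (\<forall>x\<in>T. linear_on T (\<lambda>y. f x y)) \<and> (\<forall>y\<in>T. linear_on T (\<lambda>x. f x y))"


section \<open>Smooth manifolds and tangent vectors\<close>

text \<open>A manifold is a topology \<open>M\<close> with a smooth atlas \<open>A\<close>, modelled on a Euclidean space \<open>'e\<close>.  A chart
  is its domain together with a map, whose values outside the domain are irrelevant.  The atlas need
  not be maximal.\<close>

type_synonym ('m, 'e) chart = "'m set \<times> ('m \<Rightarrow> 'e)"

definition is_chart :: "'m topology \<Rightarrow> ('m, 'e::euclidean_space) chart \<Rightarrow> bool"
  where "is_chart M c \<longleftrightarrow> openin M (fst c) \<and> open (snd c ` fst c) \<and>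
    homeomorphic_map (subtopology M (fst c)) (top_of_set (snd c ` fst c)) (snd c)"

definition chart_inv :: "('m, 'e) chart \<Rightarrow> 'e \<Rightarrow> 'm"
  where "chart_inv c = inv_into (fst c) (snd c)"

definition smooth_manifold :: "'m topology \<Rightarrow> ('m, 'e::euclidean_space) chart set \<Rightarrow> bool"
  where "smooth_manifold M A \<longleftrightarrow>
    Hausdorff_space M \<and> second_countable M \<and>
    (\<forall>c\<in>A. is_chart M c) \<and> (\<Union>c\<in>A. fst c) = topspace M \<and>
    (\<forall>c\<in>A. \<forall>d\<in>A. smooth_on (snd c ` (fst c \<inter> fst d)) (snd d \<circ> chart_inv c))"

text \<open>A tangent vector at \<open>p\<close> assigns to each chart around \<open>p\<close> the coordinates of the vector in that
  chart; the coordinates transform by the derivatives of the transition maps.  It is \<open>0\<close> on all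
  other charts, so that equality and the pointwise vector space operations are the intended ones.\<close>

type_synonym ('m, 'e) tvec = "('m, 'e) chart \<Rightarrow> 'e"

definition tangent_space ::
    "('m, 'e::euclidean_space) chart set \<Rightarrow> 'm \<Rightarrow> ('m, 'e) tvec set"
  where "tangent_space A p = {v.
    (\<forall>c\<in>A. \<forall>d\<in>A. p \<in> fst c \<and> p \<in> fst d \<longrightarrow>
       v d = frechet_derivative (snd d \<circ> chart_inv c) (at (snd c p)) (v c)) \<and>
    (\<forall>c. \<not> (c \<in> A \<and> p \<in> fst c) \<longrightarrow> v c = 0)}"

text \<open>A function, a vector field or any other field over an open set \<open>U\<close> is a total function whose
  values outside \<open>U\<close> are irrelevant.\<close>

type_synonym ('m, 'e) vfield = "'m \<Rightarrow> ('m, 'e) tvec"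

definition smooth_fun ::
    "'m topology \<Rightarrow> ('m, 'e::euclidean_space) chart set \<Rightarrow> 'm set \<Rightarrow> ('m \<Rightarrow> real) \<Rightarrow> bool"
  where "smooth_fun M A U f \<longleftrightarrow> openin M U \<and>
    (\<forall>c\<in>A. smooth_on (snd c ` (U \<inter> fst c)) (f \<circ> chart_inv c))"

definition smooth_vfield ::
    "'m topology \<Rightarrow> ('m, 'e::euclidean_space) chart set \<Rightarrow> 'm set \<Rightarrow> ('m, 'e) vfield \<Rightarrow> bool"
  where "smooth_vfield M A U X \<longleftrightarrow> openin M U \<and>
    (\<forall>p\<in>U. X p \<in> tangent_space A p) \<and>
    (\<forall>c\<in>A. smooth_on (snd c ` (U \<inter> fst c)) (\<lambda>x. X (chart_inv c x) c))"

text \<open>The derivative \<open>v(f)\<close> of a function \<open>f\<close> in the direction of the tangent vector \<open>v\<close> at \<open>p\<close>.  It does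
  not depend on the chart.\<close>

definition dir_deriv ::
    "('m, 'e::euclidean_space) chart set \<Rightarrow> 'm \<Rightarrow> ('m, 'e) tvec \<Rightarrow> ('m \<Rightarrow> real) \<Rightarrow> real"
  where "dir_deriv A p v f =
    (let c = (SOME c. c \<in> A \<and> p \<in> fst c)
     in frechet_derivative (f \<circ> chart_inv c) (at (snd c p)) (v c))"


section \<open>Riemannian metrics, one-forms and Randers metrics\<close>

text \<open>Smoothness of tensor fields is tested on smooth local vector fields.\<close>

definition riemannian_metric ::
    "'m topology \<Rightarrow> ('m, 'e::euclidean_space) chart set \<Rightarrow>
     ('m \<Rightarrow> ('m, 'e) tvec \<Rightarrow> ('m, 'e) tvec \<Rightarrow> real) \<Rightarrow> bool"
  where "riemannian_metric M A \<alpha> \<longleftrightarrow>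
    (\<forall>p\<in>topspace M. bilinear_on (tangent_space A p) (\<alpha> p) \<and>
      (\<forall>v\<in>tangent_space A p. \<forall>w\<in>tangent_space A p. \<alpha> p v w = \<alpha> p w v) \<and>
      (\<forall>v\<in>tangent_space A p. v \<noteq> 0 \<longrightarrow> \<alpha> p v v > 0)) \<and>
    (\<forall>U X Y. smooth_vfield M A U X \<and> smooth_vfield M A U Y \<longrightarrow>
      smooth_fun M A U (\<lambda>p. \<alpha> p (X p) (Y p)))"

definition one_form ::
    "'m topology \<Rightarrow> ('m, 'e::euclidean_space) chart set \<Rightarrow>
     ('m \<Rightarrow> ('m, 'e) tvec \<Rightarrow> real) \<Rightarrow> bool"
  where "one_form M A \<beta> \<longleftrightarrow>
    (\<forall>p\<in>topspace M. linear_on (tangent_space A p) (\<beta> p)) \<and>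
    (\<forall>U X. smooth_vfield M A U X \<longrightarrow> smooth_fun M A U (\<lambda>p. \<beta> p (X p)))"

definition sharp ::
    "('m, 'e::euclidean_space) chart set \<Rightarrow>
     ('m \<Rightarrow> ('m, 'e) tvec \<Rightarrow> ('m, 'e) tvec \<Rightarrow> real) \<Rightarrow>
     ('m \<Rightarrow> ('m, 'e) tvec \<Rightarrow> real) \<Rightarrow> ('m, 'e) vfield"
  where "sharp A \<alpha> \<beta> p =
    (THE b. b \<in> tangent_space A p \<and> (\<forall>y\<in>tangent_space A p. \<alpha> p b y = \<beta> p y))"

definition randers ::
    "('m \<Rightarrow> ('m, 'e) tvec \<Rightarrow> ('m, 'e) tvec \<Rightarrow> real) \<Rightarrow>
     ('m \<Rightarrow> ('m, 'e) tvec \<Rightarrow> real) \<Rightarrow> 'm \<Rightarrow> ('m, 'e) tvec \<Rightarrow> real"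
  where "randers \<alpha> \<beta> p v = sqrt (\<alpha> p v v) + \<beta> p v"


section \<open>Linear connections\<close>

text \<open>A linear connection \<open>\<nabla>\<close> is given by its covariant derivatives \<open>D p v X = \<nabla>\<^sub>v X\<close>, where \<open>v\<close> is a tangent
  vector at \<open>p\<close> and \<open>X\<close> is a vector field that is smooth on some open neighbourhood of \<open>p\<close>.  The third
  condition says that only the germ of \<open>X\<close> at \<open>p\<close> matters.\<close>

type_synonym ('m, 'e) conn = "'m \<Rightarrow> ('m, 'e) tvec \<Rightarrow> ('m, 'e) vfield \<Rightarrow> ('m, 'e) tvec"

definition linear_connection ::
    "'m topology \<Rightarrow> ('m, 'e::euclidean_space) chart set \<Rightarrow> ('m, 'e) conn \<Rightarrow> bool"
  where "linear_connection M A D \<longleftrightarrow>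
    (\<forall>U p X. smooth_vfield M A U X \<and> p \<in> U \<longrightarrow>
      (\<forall>v\<in>tangent_space A p. D p v X \<in> tangent_space A p) \<and>
      linear_on (tangent_space A p) (\<lambda>v. D p v X)) \<and>
    (\<forall>U p X Y. smooth_vfield M A U X \<and> smooth_vfield M A U Y \<and> p \<in> U \<longrightarrow>
      (\<forall>v\<in>tangent_space A p. D p v (\<lambda>q. X q + Y q) = D p v X + D p v Y)) \<and>
    (\<forall>U p X Y. smooth_vfield M A U X \<and> smooth_vfield M A U Y \<and> p \<in> U \<and> (\<forall>q\<in>U. X q = Y q) \<longrightarrow>
      (\<forall>v\<in>tangent_space A p. D p v X = D p v Y)) \<and>
    (\<forall>U p f X. smooth_fun M A U f \<and> smooth_vfield M A U X \<and> p \<in> U \<longrightarrow>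
      (\<forall>v\<in>tangent_space A p.
        D p v (\<lambda>q. f q *\<^sub>R X q) = dir_deriv A p v f *\<^sub>R X p + f p *\<^sub>R D p v X)) \<and>
    (\<forall>U X Y. smooth_vfield M A U X \<and> smooth_vfield M A U Y \<longrightarrow>
      smooth_vfield M A U (\<lambda>p. D p (X p) Y))"

definition metric_connection ::
    "'m topology \<Rightarrow> ('m, 'e::euclidean_space) chart set \<Rightarrow>
     ('m \<Rightarrow> ('m, 'e) tvec \<Rightarrow> ('m, 'e) tvec \<Rightarrow> real) \<Rightarrow> ('m, 'e) conn \<Rightarrow> bool"
  where "metric_connection M A \<alpha> D \<longleftrightarrow>
    (\<forall>U p X Y. smooth_vfield M A U X \<and> smooth_vfield M A U Y \<and> p \<in> U \<longrightarrow>
      (\<forall>v\<in>tangent_space A p.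
        dir_deriv A p v (\<lambda>q. \<alpha> q (X q) (Y q)) = \<alpha> p (D p v X) (Y p) + \<alpha> p (X p) (D p v Y)))"

text \<open>\<open>\<nabla>\<^sub>X Y - \<nabla>\<^sub>Y X = [X, Y]\<close>, where the Lie bracket is given by its action
  \<open>[X, Y] f = X (Y f) - Y (X f)\<close> on functions.\<close>

definition torsion_free ::
    "'m topology \<Rightarrow> ('m, 'e::euclidean_space) chart set \<Rightarrow> ('m, 'e) conn \<Rightarrow> bool"
  where "torsion_free M A D \<longleftrightarrow>
    (\<forall>U p f X Y. smooth_fun M A U f \<and> smooth_vfield M A U X \<and> smooth_vfield M A U Y \<and> p \<in> U \<longrightarrow>
      dir_deriv A p (D p (X p) Y - D p (Y p) X) f =
        dir_deriv A p (X p) (\<lambda>q. dir_deriv A q (Y q) f) -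
        dir_deriv A p (Y p) (\<lambda>q. dir_deriv A q (X q) f))"

definition levi_civita ::
    "'m topology \<Rightarrow> ('m, 'e::euclidean_space) chart set \<Rightarrow>
     ('m \<Rightarrow> ('m, 'e) tvec \<Rightarrow> ('m, 'e) tvec \<Rightarrow> real) \<Rightarrow> ('m, 'e) conn \<Rightarrow> bool"
  where "levi_civita M A \<alpha> D \<longleftrightarrow>
    linear_connection M A D \<and> metric_connection M A \<alpha> D \<and> torsion_free M A D"


section \<open>Parallel transport and compatibility\<close>

text \<open>Curves are parametrized by open intervals.  A smooth curve on a compact interval extends to
  a larger open one, and parallel transport along a piecewise smooth curve is a composition of
  parallel transports along smooth ones.\<close>

definition smooth_curve ::
    "'m topology \<Rightarrow> ('m, 'e::euclidean_space) chart set \<Rightarrow> real set \<Rightarrow> (real \<Rightarrow> 'm) \<Rightarrow> bool"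
  where "smooth_curve M A I \<gamma> \<longleftrightarrow> open I \<and> is_interval I \<and>
    continuous_map (top_of_set I) M \<gamma> \<and>
    (\<forall>c\<in>A. smooth_on {t\<in>I. \<gamma> t \<in> fst c} (snd c \<circ> \<gamma>))"

definition velocity ::
    "('m, 'e::euclidean_space) chart set \<Rightarrow> (real \<Rightarrow> 'm) \<Rightarrow> real \<Rightarrow> ('m, 'e) tvec"
  where "velocity A \<gamma> t = (\<lambda>c. if c \<in> A \<and> \<gamma> t \<in> fst c
    then vector_derivative (snd c \<circ> \<gamma>) (at t) else 0)"

text \<open>\<open>has_covariant_derivative M A D \<gamma> V t w\<close>: the vector field \<open>V\<close> along \<open>\<gamma>\<close> has the covariant derivative
  \<open>w\<close> at \<open>t\<close>.  Near \<open>t\<close> one writes \<open>V\<close> as \<open>\<Sum>\<^sub>i a\<^sub>i \<cdot> (E\<^sub>i \<circ> \<gamma>)\<close>, e.g. with a local frame \<open>E\<close>, and then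
  \<open>w = \<Sum>\<^sub>i (a\<^sub>i' E\<^sub>i + a\<^sub>i \<nabla>\<^bsub>\<gamma>'\<^esub> E\<^sub>i)\<close>; the result does not depend on the representation.\<close>

definition has_covariant_derivative ::
    "'m topology \<Rightarrow> ('m, 'e::euclidean_space) chart set \<Rightarrow> ('m, 'e) conn \<Rightarrow>
     (real \<Rightarrow> 'm) \<Rightarrow> (real \<Rightarrow> ('m, 'e) tvec) \<Rightarrow> real \<Rightarrow> ('m, 'e) tvec \<Rightarrow> bool"
  where "has_covariant_derivative M A D \<gamma> V t w \<longleftrightarrow>
    (\<exists>U (k::nat) E a a'. \<gamma> t \<in> U \<and>
      (\<forall>i<k. smooth_vfield M A U (E i) \<and> (a i has_real_derivative a' i) (at t)) \<and>
      (\<forall>\<^sub>F s in nhds t. V s = (\<Sum>i<k. a i s *\<^sub>R E i (\<gamma> s))) \<and>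
      w = (\<Sum>i<k. a' i *\<^sub>R E i (\<gamma> t) + a i t *\<^sub>R D (\<gamma> t) (velocity A \<gamma> t) (E i)))"

definition parallel_along ::
    "'m topology \<Rightarrow> ('m, 'e::euclidean_space) chart set \<Rightarrow> ('m, 'e) conn \<Rightarrow>
     real set \<Rightarrow> (real \<Rightarrow> 'm) \<Rightarrow> (real \<Rightarrow> ('m, 'e) tvec) \<Rightarrow> bool"
  where "parallel_along M A D I \<gamma> V \<longleftrightarrow>
    (\<forall>t\<in>I. V t \<in> tangent_space A (\<gamma> t) \<and> has_covariant_derivative M A D \<gamma> V t 0)"

text \<open>The graph of the parallel transport from \<open>\<gamma> s\<close> to \<open>\<gamma> t\<close> along \<open>\<gamma>\<close>.\<close>

definition parallel_transport ::
    "'m topology \<Rightarrow> ('m, 'e::euclidean_space) chart set \<Rightarrow> ('m, 'e) conn \<Rightarrow>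
     real set \<Rightarrow> (real \<Rightarrow> 'm) \<Rightarrow> real \<Rightarrow> real \<Rightarrow> ('m, 'e) tvec \<Rightarrow> ('m, 'e) tvec \<Rightarrow> bool"
  where "parallel_transport M A D I \<gamma> s t v w \<longleftrightarrow>
    (\<exists>V. parallel_along M A D I \<gamma> V \<and> V s = v \<and> V t = w)"

definition compatible ::
    "'m topology \<Rightarrow> ('m, 'e::euclidean_space) chart set \<Rightarrow>
     ('m \<Rightarrow> ('m, 'e) tvec \<Rightarrow> real) \<Rightarrow> ('m, 'e) conn \<Rightarrow> bool"
  where "compatible M A F D \<longleftrightarrow>
    (\<forall>I \<gamma> s t v w. smooth_curve M A I \<gamma> \<and> s \<in> I \<and> t \<in> I \<and>
      parallel_transport M A D I \<gamma> s t v w \<longrightarrow> F (\<gamma> t) w = F (\<gamma> s) v)"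


section \<open>The optimization problem\<close>

definition orthonormal_basis ::
    "('m, 'e::euclidean_space) chart set \<Rightarrow>
     ('m \<Rightarrow> ('m, 'e) tvec \<Rightarrow> ('m, 'e) tvec \<Rightarrow> real) \<Rightarrow> 'm \<Rightarrow> ('m, 'e) tvec set \<Rightarrow> bool"
  where "orthonormal_basis A \<alpha> p B \<longleftrightarrow> finite B \<and> span B = tangent_space A p \<and>
    (\<forall>e\<in>B. \<forall>f\<in>B. \<alpha> p e f = (if e = f then 1 else 0))"

text \<open>The square of the norm of an endomorphism of the tangent space at \<open>p\<close>: the sum of the squares of
  its matrix entries in an orthonormal basis, which does not depend on the choice of the basis.\<close>

definition endo_norm_sq ::
    "('m, 'e::euclidean_space) chart set \<Rightarrow>
     ('m \<Rightarrow> ('m, 'e) tvec \<Rightarrow> ('m, 'e) tvec \<Rightarrow> real) \<Rightarrow> 'm \<Rightarrow>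
     (('m, 'e) tvec \<Rightarrow> ('m, 'e) tvec) \<Rightarrow> real"
  where "endo_norm_sq A \<alpha> p L =
    (let B = (SOME B. orthonormal_basis A \<alpha> p B) in \<Sum>e\<in>B. \<Sum>f\<in>B. (\<alpha> p (L f) e)\<^sup>2)"

text \<open>In the following, \<open>T\<close> is the value at \<open>p\<close> of the unknown tensor of type (1,2), and \<open>b\<close> is the vector
  field \<open>\<beta>\<^sup>\<sharp>\<close>.  The vector \<open>x\<close> is the value of the vector field \<open>X\<close> at \<open>p\<close>, and \<open>T x\<close> is \<open>\<iota>\<^sub>X A\<close>.\<close>

definition feasible ::
    "('m, 'e::euclidean_space) chart set \<Rightarrow>
     ('m \<Rightarrow> ('m, 'e) tvec \<Rightarrow> ('m, 'e) tvec \<Rightarrow> real) \<Rightarrow> ('m, 'e) vfield \<Rightarrow> ('m, 'e) conn \<Rightarrow>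
     'm \<Rightarrow> (('m, 'e) tvec \<Rightarrow> ('m, 'e) tvec \<Rightarrow> ('m, 'e) tvec) \<Rightarrow> bool"
  where "feasible A \<alpha> b D p T \<longleftrightarrow>
    bilinear_on (tangent_space A p) T \<and>
    (\<forall>x\<in>tangent_space A p. \<forall>y\<in>tangent_space A p. T x y \<in> tangent_space A p) \<and>
    (\<forall>x\<in>tangent_space A p. \<forall>y\<in>tangent_space A p. \<forall>z\<in>tangent_space A p.
      \<alpha> p (T x y) z = - \<alpha> p (T x z) y) \<and>
    (\<forall>x\<in>tangent_space A p. T x (b p) = - D p x b)"

definition pointwise_solution ::
    "('m, 'e::euclidean_space) chart set \<Rightarrow>
     ('m \<Rightarrow> ('m, 'e) tvec \<Rightarrow> ('m, 'e) tvec \<Rightarrow> real) \<Rightarrow> ('m, 'e) vfield \<Rightarrow> ('m, 'e) conn \<Rightarrow>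
     'm \<Rightarrow> (('m, 'e) tvec \<Rightarrow> ('m, 'e) tvec \<Rightarrow> ('m, 'e) tvec) \<Rightarrow> bool"
  where "pointwise_solution A \<alpha> b D p T \<longleftrightarrow> feasible A \<alpha> b D p T \<and>
    (\<forall>T'. feasible A \<alpha> b D p T' \<longrightarrow>
      (\<forall>x\<in>tangent_space A p. endo_norm_sq A \<alpha> p (T x) \<le> endo_norm_sq A \<alpha> p (T' x)))"

definition difference_tensor ::
    "('m \<Rightarrow> ('m, 'e) tvec \<Rightarrow> ('m, 'e) tvec \<Rightarrow> real) \<Rightarrow> ('m, 'e::euclidean_space) vfield \<Rightarrow>
     ('m, 'e) conn \<Rightarrow> real \<Rightarrow> 'm \<Rightarrow> ('m, 'e) tvec \<Rightarrow> ('m, 'e) tvec \<Rightarrow> ('m, 'e) tvec"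
  where "difference_tensor \<alpha> b D K p x y =
    (\<alpha> p (D p x b) y / K\<^sup>2) *\<^sub>R b p - (\<alpha> p y (b p) / K\<^sup>2) *\<^sub>R D p x b"

end

theory Submission
  imports Defs
begin

text \<open>If parallel transport preserves \<open>F\<close>, then applying this to \<open>v\<close> and \<open>- v\<close> shows that it
  preserves \<open>\<alpha>\<close> and \<open>\<beta>\<close> separately, hence also the length of \<open>\<beta>\<^sup>\<sharp>\<close>, which is thus locally constant.
  Parallel fields along coordinate lines exist because in a frame they are the solutions of a linear
  differential equation.

  Conversely, if \<open>\<beta>\<^sup>\<sharp>\<close> has constant length \<open>K\<close>, then \<open>\<nabla>\<^sup>*\<^sub>X \<beta>\<^sup>\<sharp>\<close> is orthogonal to \<open>\<beta>\<^sup>\<sharp>\<close>, and so \<open>\<nabla>\<^sup>* + A\<close> is a metric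
  connection with \<open>\<beta>\<^sup>\<sharp>\<close> parallel; along its parallel fields \<open>V\<close> both \<open>\<alpha>(V, V)\<close> and \<open>\<alpha>(\<beta>\<^sup>\<sharp>, V) = \<beta>(V)\<close> have
  zero derivative.  Any other feasible tensor differs from \<open>A\<close> by one that is orthogonal to \<open>A\<close>, which
  gives minimality and uniqueness by Pythagoras.\<close>

section \<open>Calculus of \<open>C\<^sup>k\<close> maps\<close>

text \<open>\<open>parallel_transport\<close> is only a relation, so \<open>compatible\<close> says
  nothing along a curve that carries no parallel field. Necessity therefore has to construct such
  fields, for every initial vector on one common interval and linearly in that vector; sufficiency
  takes any given field. Linearity is what makes the pair \<open>v\<close>, \<open>- v\<close>
  useful: the norm part of \<open>F\<close> is even and the form part is odd.

  A \<open>tvec\<close> is a function on charts, so its type is not Euclidean. Orthonormal frames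
  carry differential equations, Cauchy-Schwarz and dimension counts over to \<open>'e\<close>.

  Origin of the formula for the difference tensor: the constraints fix its value at the dual field
  and, by skewness, the component of every value along that field. What remains free is a skew
  endomorphism of the orthogonal complement of the dual field, and the formula sets this part to
  zero.\<close>

lemma Ck_on_Suc_imp_Ck_on: "Ck_on (Suc k) S f \<Longrightarrow> Ck_on k S f"
proof (induction k arbitrary: f)
  case 0
  then show ?case
    by (auto intro!: continuous_at_imp_continuous_on differentiable_imp_continuous_within)
next
  case (Suc k)
  have "Ck_on k S (\<lambda>x. frechet_derivative f (at x) v)" for v
    using Suc.prems by (intro Suc.IH) (simp only: Ck_on.simps(2)[of "Suc k"])
  then show ?case using Suc.prems unfolding Ck_on.simps(2)[of "Suc k"] Ck_on.simps(2)[of k] by blast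
qed

lemma Ck_on_subset: "Ck_on k S f \<Longrightarrow> T \<subseteq> S \<Longrightarrow> Ck_on k T f"
  by (induction k arbitrary: f) (auto intro: continuous_on_subset)

lemma Ck_on_SucD:
  "Ck_on (Suc k) S f \<Longrightarrow> x \<in> S \<Longrightarrow> (f has_derivative frechet_derivative f (at x)) (at x)"
  unfolding Ck_on.simps frechet_derivative_works by blast

text \<open>\<open>frechet_derivative\<close> at a point depends on a full neighbourhood, so
  agreement on \<open>S\<close> carries over to the derivatives because \<open>S\<close> is
  open.\<close>

lemma Ck_on_cong:
  assumes "open S" "\<And>x. x \<in> S \<Longrightarrow> f x = g x" "Ck_on k S f"
  shows "Ck_on k S g"
  using assms(2,3)
proof (induction k arbitrary: f g)
  case 0
  have "continuous_on S f = continuous_on S g"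
    by (rule continuous_on_cong[OF refl]) (rule 0(1))
  then show ?case using 0(2) by simp
next
  case (Suc k)
  have D: "(g has_derivative frechet_derivative f (at x)) (at x)" if "x \<in> S" for x
    by (rule has_derivative_transform_within_open[OF Ck_on_SucD[OF Suc.prems(2) that] assms(1) that])
      (rule Suc.prems(1))
  have eq: "frechet_derivative f (at x) v = frechet_derivative g (at x) v" if "x \<in> S" for x v
    using frechet_derivative_at[OF D[OF that]] by simp
  have "Ck_on k S (\<lambda>x. frechet_derivative g (at x) v)" for v
  proof (rule Suc.IH)
    show "Ck_on k S (\<lambda>x. frechet_derivative f (at x) v)" using Suc.prems(2) by simp
  qed (rule eq)
  moreover have "\<forall>x\<in>S. g differentiable at x"
    using D unfolding differentiable_def by blast
  ultimately show ?case by simp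
qed

text \<open>Derivatives are unique, so any candidate found by the calculus rules may replace the
  chosen \<open>frechet_derivative\<close>. Sums, products, compositions and powers enter their
  induction step through this rule.\<close>

lemma Ck_on_SucI:
  assumes "open S" "\<And>x. x \<in> S \<Longrightarrow> (f has_derivative f' x) (at x)"
    "\<And>v. Ck_on k S (\<lambda>x. f' x v)"
  shows "Ck_on (Suc k) S f"
proof -
  have "f' x v = frechet_derivative f (at x) v" if "x \<in> S" for x v
    using frechet_derivative_at[OF assms(2)[OF that]] by simp
  then have "Ck_on k S (\<lambda>x. frechet_derivative f (at x) v)" for v
    by (rule Ck_on_cong[OF assms(1) _ assms(3)[of v]])
  moreover have "\<forall>x\<in>S. f differentiable at x"
    using assms(2) unfolding differentiable_def by blast
  ultimately show ?thesis by simp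
qed

lemma Ck_on_const: "Ck_on k S (\<lambda>x. c)"
proof (induction k arbitrary: c)
  case (Suc k)
  then show ?case by (simp add: frechet_derivative_const)
qed simp

lemma Ck_on_bounded_linear: "open S \<Longrightarrow> bounded_linear f \<Longrightarrow> Ck_on k S f"
proof (induction k)
  case 0
  then show ?case by (simp add: linear_continuous_on)
next
  case (Suc k)
  then show ?case
    by (intro Ck_on_SucI[where f'="\<lambda>_. f"]) (auto intro: bounded_linear_imp_has_derivative Ck_on_const)
qed

lemma Ck_on_add:
  assumes "open S" "Ck_on k S f" "Ck_on k S g"
  shows "Ck_on k S (\<lambda>x. f x + g x)"
  using assms(2,3)
proof (induction k arbitrary: f g)
  case 0
  then show ?case by (simp add: continuous_on_add)
next
  case (Suc k)
  show ?case
    by (rule Ck_on_SucI[where f'="\<lambda>x v. frechet_derivative f (at x) v + frechet_derivative g (at x) v"])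
      (use Suc assms(1) in \<open>auto intro!: has_derivative_add simp: frechet_derivative_works\<close>)
qed

lemma Ck_on_sum:
  "open S \<Longrightarrow> (\<And>i. i \<in> I \<Longrightarrow> Ck_on k S (f i)) \<Longrightarrow> Ck_on k S (\<lambda>x. \<Sum>i\<in>I. f i x)"
  by (induction I rule: infinite_finite_induct) (auto intro: Ck_on_const Ck_on_add)

text \<open>The product rule yields two terms of the same shape with the same \<open>b\<close>;
  hence the induction over all \<open>f\<close> and \<open>g\<close>, in which the undifferentiated
  factor is lowered to \<open>Ck_on k\<close>.\<close>

lemma Ck_on_bilinear:
  assumes "open S" "bounded_bilinear b" "Ck_on k S f" "Ck_on k S g"
  shows "Ck_on k S (\<lambda>x. b (f x) (g x))"
  using assms(3,4)
proof (induction k arbitrary: f g)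
  case 0
  then show ?case by (simp add: bounded_bilinear.continuous_on[OF assms(2)])
next
  case (Suc k)
  show ?case
  proof (rule Ck_on_SucI[OF assms(1)])
    show "((\<lambda>x. b (f x) (g x)) has_derivative
      (\<lambda>v. b (f x) (frechet_derivative g (at x) v) + b (frechet_derivative f (at x) v) (g x))) (at x)"
      if "x \<in> S" for x
      by (rule bounded_bilinear.FDERIV[OF assms(2) Ck_on_SucD Ck_on_SucD, OF Suc.prems(1) that Suc.prems(2) that])
    have "Ck_on k S f" "Ck_on k S g"
      using Suc.prems by (simp_all only: Ck_on_Suc_imp_Ck_on)
    then show "Ck_on k S (\<lambda>x. b (f x) (frechet_derivative g (at x) v) + b (frechet_derivative f (at x) v) (g x))" for v
      using Suc.prems by (intro Ck_on_add[OF assms(1)] Suc.IH) simp_all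
  qed
qed

text \<open>In the chain rule the direction \<open>?g' x v\<close> varies with \<open>x\<close>, so
  the derivative is not a map composed with \<open>g\<close> and the induction hypothesis does not
  apply to it. Expanding that direction in \<open>Basis\<close> leaves derivatives of
  \<open>f\<close> in constant directions, composed with \<open>g\<close> and multiplied by scalar
  functions.\<close>

lemma Ck_on_compose:
  fixes f :: "'b::euclidean_space \<Rightarrow> 'c::real_normed_vector"
  assumes "open S" "Ck_on k T f" "Ck_on k S g" "g ` S \<subseteq> T"
  shows "Ck_on k S (f \<circ> g)"
  using assms(2,3)
proof (induction k arbitrary: f)
  case 0
  then show ?case using continuous_on_compose2[OF _ _ assms(4), of f] by (simp add: comp_def)
next
  case (Suc k)
  let ?f' = "\<lambda>x. frechet_derivative f (at x)" and ?g' = "\<lambda>x. frechet_derivative g (at x)"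
  show ?case
  proof (rule Ck_on_SucI[OF assms(1)])
    fix x assume x: "x \<in> S"
    then have gx: "g x \<in> T" using assms(4) by auto
    have f': "(f has_derivative ?f' (g x)) (at (g x))" by (rule Ck_on_SucD[OF Suc.prems(1) gx])
    have "(f \<circ> g has_derivative ?f' (g x) \<circ> ?g' x) (at x)"
      by (rule diff_chain_at[OF Ck_on_SucD[OF Suc.prems(2) x] f'])
    moreover have "(?f' (g x) \<circ> ?g' x) v = (\<Sum>b\<in>Basis. (?g' x v \<bullet> b) *\<^sub>R ?f' (g x) b)" for v
    proof -
      interpret linear "?f' (g x)" using f' has_derivative_linear by blast
      have "?f' (g x) (?g' x v) = ?f' (g x) (\<Sum>b\<in>Basis. (?g' x v \<bullet> b) *\<^sub>R b)"
        by (simp add: euclidean_representation)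
      then show ?thesis by (simp add: sum scaleR)
    qed
    ultimately show "(f \<circ> g has_derivative (\<lambda>v. \<Sum>b\<in>Basis. (?g' x v \<bullet> b) *\<^sub>R ?f' (g x) b)) (at x)"
      by (rule has_derivative_eq_rhs[OF _ ext])
  next
    fix v
    have "Ck_on k S ((\<lambda>y. ?f' y b) \<circ> g)" for b
      using Suc.prems by (intro Suc.IH Ck_on_Suc_imp_Ck_on[OF Suc.prems(2)]) simp
    moreover have "Ck_on k S (\<lambda>x. ?g' x v)" using Suc.prems by simp
    ultimately show "Ck_on k S (\<lambda>x. \<Sum>b\<in>Basis. (?g' x v \<bullet> b) *\<^sub>R ?f' (g x) b)"
      using assms(1) unfolding comp_def
      by (intro Ck_on_sum Ck_on_bilinear[OF _ bounded_bilinear_scaleR]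
          Ck_on_bilinear[OF _ bounded_bilinear_inner] Ck_on_const)
  qed
qed

lemma Ck_on_open_cover:
  assumes "\<And>x. x \<in> S \<Longrightarrow> \<exists>T. open T \<and> x \<in> T \<and> Ck_on k T f"
  shows "Ck_on k S f"
  using assms
proof (induction k arbitrary: f)
  case 0
  have "continuous (at x) f" if "x \<in> S" for x
    using 0[OF that] continuous_on_eq_continuous_at by auto
  then show ?case by (simp add: continuous_at_imp_continuous_on)
next
  case (Suc k)
  have "Ck_on k S (\<lambda>x. frechet_derivative f (at x) v)" for v
  proof (rule Suc.IH)
    show "\<exists>T. open T \<and> x \<in> T \<and> Ck_on k T (\<lambda>x. frechet_derivative f (at x) v)" if "x \<in> S" for x
      using Suc.prems[OF that] by auto
  qed
  moreover have "f differentiable at x" if "x \<in> S" for x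
    using Suc.prems[OF that] by auto
  ultimately show ?case by simp
qed

text \<open>The family in \<open>c\<close> and \<open>a\<close> is closed under differentiation, so
  the induction runs over the whole family. The exponent -1/2 is the one used later, to normalise
  vector fields.\<close>

lemma Ck_on_powr: "Ck_on k {0<..} (\<lambda>x::real. c * x powr a)"
proof (induction k arbitrary: c a)
  case 0
  then show ?case by (auto intro!: continuous_intros)
next
  case (Suc k)
  show ?case
  proof (rule Ck_on_SucI[where f'="\<lambda>x v. (c * a * v) * x powr (a - 1)"])
    show "((\<lambda>x. c * x powr a) has_derivative (\<lambda>v. c * a * v * x powr (a - 1))) (at x)"
      if "x \<in> {0<..}" for x
    proof -
      have "((\<lambda>x. c * x powr a) has_real_derivative c * (a * x powr (a - 1))) (at x)"
        using that by (intro DERIV_cmult has_real_derivative_powr) simp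
      then show ?thesis
        unfolding has_field_derivative_def
        by (rule has_derivative_eq_rhs) (simp add: fun_eq_iff)
    qed
  qed (auto intro: Suc)
qed

section \<open>Smooth maps, as the maps that are of every finite class\<close>

lemma smooth_on_subset: "smooth_on S f \<Longrightarrow> T \<subseteq> S \<Longrightarrow> smooth_on T f"
  by (auto simp: smooth_on_def intro: Ck_on_subset)

lemma smooth_on_cong:
  "open S \<Longrightarrow> (\<And>x. x \<in> S \<Longrightarrow> f x = g x) \<Longrightarrow> smooth_on S f \<Longrightarrow> smooth_on S g"
  unfolding smooth_on_def using Ck_on_cong[of S f g] by simp

lemma smooth_on_const: "smooth_on S (\<lambda>x. c)"
  by (simp add: smooth_on_def Ck_on_const)

lemma smooth_on_bounded_linear: "open S \<Longrightarrow> bounded_linear f \<Longrightarrow> smooth_on S f"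
  by (simp add: smooth_on_def Ck_on_bounded_linear)

lemma smooth_on_add:
  "open S \<Longrightarrow> smooth_on S f \<Longrightarrow> smooth_on S g \<Longrightarrow> smooth_on S (\<lambda>x. f x + g x)"
  by (simp add: smooth_on_def Ck_on_add)

lemma smooth_on_bilinear:
  "open S \<Longrightarrow> bounded_bilinear b \<Longrightarrow> smooth_on S f \<Longrightarrow> smooth_on S g \<Longrightarrow>
    smooth_on S (\<lambda>x. b (f x) (g x))"
  by (simp add: smooth_on_def Ck_on_bilinear)

lemma smooth_on_compose:
  fixes f :: "'b::euclidean_space \<Rightarrow> 'c::real_normed_vector"
  shows "open S \<Longrightarrow> smooth_on T f \<Longrightarrow> smooth_on S g \<Longrightarrow> g ` S \<subseteq> T \<Longrightarrow> smooth_on S (f \<circ> g)"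
  unfolding smooth_on_def using Ck_on_compose[of S _ T f g] by simp

lemma smooth_on_open_cover:
  assumes "\<And>x. x \<in> S \<Longrightarrow> \<exists>T. open T \<and> x \<in> T \<and> smooth_on T f"
  shows "smooth_on S f"
  unfolding smooth_on_def
proof (intro allI Ck_on_open_cover)
  fix k x assume "x \<in> S"
  from assms[OF this] show "\<exists>T. open T \<and> x \<in> T \<and> Ck_on k T f"
    unfolding smooth_on_def by auto
qed

lemma smooth_on_rsqrt: "smooth_on {0<..} (\<lambda>x::real. 1 / sqrt x)"
proof (rule smooth_on_cong[where f="\<lambda>x. 1 * x powr (- (1/2))"])
  show "smooth_on {0<..} (\<lambda>x::real. 1 * x powr (- (1/2)))"
    unfolding smooth_on_def by (rule allI) (rule Ck_on_powr)
  show "1 * x powr (- (1/2)) = 1 / sqrt x" if "x \<in> {0<..}" for x :: real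
  proof -
    have "x powr (- (1/2)) = inverse (x powr (1/2))" by (rule powr_minus)
    also have "x powr (1/2) = sqrt x" using that by (intro powr_half_sqrt) simp
    finally show ?thesis by (simp only: inverse_eq_divide mult_1)
  qed
qed (rule open_greaterThan)

lemma smooth_on_imp_has_derivative:
  "smooth_on S f \<Longrightarrow> x \<in> S \<Longrightarrow> (f has_derivative frechet_derivative f (at x)) (at x)"
  unfolding smooth_on_def by (erule allE[of _ "Suc 0"]) (rule Ck_on_SucD)

lemma smooth_on_frechet_derivative:
  "smooth_on S f \<Longrightarrow> smooth_on S (\<lambda>x. frechet_derivative f (at x) v)"
  unfolding smooth_on_def
proof (intro allI)
  fix k assume "\<forall>k. Ck_on k S f"
  then have "Ck_on (Suc k) S f" ..
  then show "Ck_on k S (\<lambda>x. frechet_derivative f (at x) v)" by simp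
qed

lemma smooth_on_imp_continuous_on: "smooth_on S f \<Longrightarrow> continuous_on S f"
  unfolding smooth_on_def Ck_on.simps(1)[symmetric] by (rule spec)

section \<open>Local solutions of Lipschitz differential equations\<close>

text \<open>The right-hand side is Lipschitz on the whole space, so solutions need not be confined
  to a ball and \<open>\<delta>\<close> depends on \<open>L\<close> and \<open>d\<close> only. One
  interval for all initial values \<open>v\<close> is what later allows solutions to be
  superposed.\<close>

lemma picard_lindelof:
  fixes f :: "real \<Rightarrow> 'a::banach \<Rightarrow> 'a"
  assumes d: "0 < d" and cont: "continuous_on ({-d..d} \<times> UNIV) (\<lambda>(t, y). f t y)"
    and lip: "\<And>t y z. t \<in> {-d..d} \<Longrightarrow> norm (f t y - f t z) \<le> L * norm (y - z)"
  obtains \<delta> where "0 < \<delta>" "\<delta> \<le> d"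
    "\<And>v. \<exists>y. y 0 = v \<and> (\<forall>t\<in>{-\<delta><..<\<delta>}. (y has_vector_derivative f t (y t)) (at t))"
proof
  \<comment> \<open>Each of the two integrals in \<open>F\<close> changes by at most
    \<open>(\<bar>L\<bar> + 1) * (2 * \<delta>)\<close> times the distance of the arguments, so the
    factor 8 yields the contraction constant 1/2. The summand 1 keeps the denominator
    positive.\<close>
  define \<delta> where "\<delta> = min d (1 / (8 * (\<bar>L\<bar> + 1)))"
  show \<delta>: "0 < \<delta>" "\<delta> \<le> d" using d by (auto simp: \<delta>_def)
  have "\<delta> \<le> 1 / (8 * (\<bar>L\<bar> + 1))" by (simp add: \<delta>_def)
  then have L\<delta>: "8 * (\<bar>L\<bar> + 1) * \<delta> \<le> 1" by (simp add: field_simps)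
  let ?I = "{-\<delta>..\<delta>}"
  fix v :: 'a
  have cont_y: "continuous_on ?I (\<lambda>s. f s (y s))" if "continuous_on ?I y" for y
  proof -
    have "continuous_on ?I (\<lambda>s. (s, y s))" by (intro continuous_intros that)
    then have "continuous_on ?I (\<lambda>s. (\<lambda>(t, y). f t y) (s, y s))"
      by (rule continuous_on_compose2[OF cont]) (use \<delta> in auto)
    then show ?thesis by simp
  qed
  \<comment> \<open>\<open>integral\<close> over \<open>{0..t}\<close> is 0 for negative
    \<open>t\<close>. Both integrals therefore start at \<open>- \<delta>\<close>, and their
    difference is the oriented integral from 0 to \<open>t\<close>.\<close>
  define F where "F y t = v + (integral {-\<delta>..t} (\<lambda>s. f s (y s)) - integral {-\<delta>..0} (\<lambda>s. f s (y s)))"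
    for y :: "real \<Rightarrow> 'a" and t
  have F_deriv: "(F y has_vector_derivative f t (y t)) (at t within ?I)"
    if y: "continuous_on ?I y" and t: "t \<in> ?I" for y t
  proof -
    have "((\<lambda>t. v + (integral {-\<delta>..t} (\<lambda>s. f s (y s)) - integral {-\<delta>..0} (\<lambda>s. f s (y s))))
       has_vector_derivative 0 + (f t (y t) - 0)) (at t within ?I)"
      by (rule has_vector_derivative_add[OF has_vector_derivative_const
            has_vector_derivative_diff[OF integral_has_vector_derivative[OF cont_y[OF y] t]
              has_vector_derivative_const]])
    then show ?thesis by (simp add: F_def[abs_def])
  qed
  have F_cont: "continuous_on ?I (F y)" if "continuous_on ?I y" for y
    unfolding continuous_on_eq_continuous_within
    using F_deriv[OF that] has_vector_derivative_continuous by blast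
  have cont_b: "continuous_on ?I (apply_bcontfun y)" for y :: "real \<Rightarrow>\<^sub>C 'a"
    using apply_bcontfun[of y] by (auto simp: bcontfun_def intro: continuous_on_subset)
  \<comment> \<open>The fixed point is sought in the complete space of bounded continuous functions
    on the whole line; \<open>clamp\<close> extends \<open>F y\<close> beyond the compact interval
    by its boundary values.\<close>
  have "\<exists>g. \<forall>x. apply_bcontfun g x = F (apply_bcontfun y) (clamp (-\<delta>) \<delta> x)" for y
    using F_cont[OF cont_b[of y]] by (metis continuous_on_cbox_bcontfunE cbox_interval)
  then obtain P where P: "\<And>y x. apply_bcontfun (P y) x = F (apply_bcontfun y) (clamp (-\<delta>) \<delta> x)"
    by metis
  have clamp: "clamp (-\<delta>) \<delta> x \<in> ?I" for x :: real
    using clamp_in_interval[of "-\<delta>" \<delta> x] \<delta>(1) by (simp add: cbox_interval)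
  have bound: "norm (integral {-\<delta>..t} (\<lambda>s. f s (y s)) - integral {-\<delta>..t} (\<lambda>s. f s (z s)))
      \<le> (\<bar>L\<bar> + 1) * dist y z * (2 * \<delta>)" if t: "t \<in> ?I" for t and y z :: "real \<Rightarrow>\<^sub>C 'a"
  proof -
    have sub: "{-\<delta>..t} \<subseteq> ?I" using t by auto
    have c: "continuous_on {-\<delta>..t} (\<lambda>s. f s (y s))" for y :: "real \<Rightarrow>\<^sub>C 'a"
      by (rule continuous_on_subset[OF cont_y[OF cont_b] sub])
    have "norm (f s (y s) - f s (z s)) \<le> (\<bar>L\<bar> + 1) * dist y z" if "s \<in> {-\<delta>..t}" for s
    proof -
      have "norm (f s (y s) - f s (z s)) \<le> L * norm (y s - z s)"
        using that sub \<delta> by (intro lip) auto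
      also have "\<dots> \<le> (\<bar>L\<bar> + 1) * dist y z"
        using dist_bounded[of y s z] by (intro mult_mono) (auto simp: dist_norm)
      finally show ?thesis .
    qed
    then have "norm (integral {-\<delta>..t} (\<lambda>s. f s (y s) - f s (z s))) \<le> (\<bar>L\<bar> + 1) * dist y z * (t - - \<delta>)"
      using t by (intro integral_bound continuous_on_diff c) auto
    also have "\<dots> \<le> (\<bar>L\<bar> + 1) * dist y z * (2 * \<delta>)"
      using t by (intro mult_left_mono) auto
    finally show ?thesis
      by (simp add: integral_diff integrable_continuous_real c)
  qed
  have "dist (P y) (P z) \<le> 1/2 * dist y z" for y z
  proof (rule dist_bound)
    fix x
    let ?t = "clamp (-\<delta>) \<delta> x"
    let ?a = "integral {-\<delta>..?t} (\<lambda>s. f s (y s)) - integral {-\<delta>..?t} (\<lambda>s. f s (z s))"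
    let ?b = "integral {-\<delta>..0} (\<lambda>s. f s (y s)) - integral {-\<delta>..0} (\<lambda>s. f s (z s))"
    have "dist (P y x) (P z x) = norm (?a - ?b)"
      by (simp add: P F_def dist_norm algebra_simps)
    also have "\<dots> \<le> norm ?a + norm ?b" by (rule norm_triangle_ineq4)
    also have "\<dots> \<le> (\<bar>L\<bar> + 1) * dist y z * (2 * \<delta>) + (\<bar>L\<bar> + 1) * dist y z * (2 * \<delta>)"
      using \<delta> by (intro add_mono bound clamp) auto
    also have "\<dots> = (8 * (\<bar>L\<bar> + 1) * \<delta>) * (1/2 * dist y z)" by (simp add: algebra_simps)
    also have "\<dots> \<le> 1 * (1/2 * dist y z)"
      by (rule mult_right_mono[OF L\<delta>]) simp
    finally show "dist (P y x) (P z x) \<le> 1/2 * dist y z" by simp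
  qed
  then have "\<exists>!y. P y = y" by (intro banach_fix_type[of "1/2"]) auto
  then obtain y where y: "P y = y" by auto
  have yF: "y t = F y t" if "t \<in> ?I" for t
  proof -
    have "y t = F y (clamp (-\<delta>) \<delta> t)" using P[of y t] by (simp add: y)
    also have "clamp (-\<delta>) \<delta> t = t" using that by (intro clamp_cancel_cbox) (simp add: cbox_interval)
    finally show ?thesis .
  qed
  show "\<exists>y. y 0 = v \<and> (\<forall>t\<in>{-\<delta><..<\<delta>}. (y has_vector_derivative f t (y t)) (at t))"
  proof (intro exI[of _ "apply_bcontfun y"] conjI ballI)
    show "y 0 = v" using yF[of 0] \<delta> by (simp add: F_def)
    fix t assume t: "t \<in> {-\<delta><..<\<delta>}"
    then have "at t within ?I = at t" by (intro at_within_interior) simp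
    then have "(F y has_vector_derivative f t (y t)) (at t)"
      using F_deriv[OF cont_b, of t y] t by simp
    then show "(y has_vector_derivative f t (y t)) (at t)"
      by (rule has_vector_derivative_transform_within_open[where S="{-\<delta><..<\<delta>}"]) (use t yF in auto)
  qed
qed

section \<open>Charts, tangent spaces and smooth fields\<close>

lemma scaleR_fun_apply [simp]: "(r *\<^sub>R f) x = r *\<^sub>R f x"
  by (simp add: scaleR_fun_def)

lemma sum_fun_apply: "(\<Sum>i\<in>I. f i) x = (\<Sum>i\<in>I. f i x)"
  by (induction I rule: infinite_finite_induct) auto

locale manifold =
  fixes M :: "'m topology" and A :: "('m, 'e::euclidean_space) chart set"
  assumes smooth_manifold: "smooth_manifold M A"
begin

lemma chart_exists: "p \<in> topspace M \<Longrightarrow> \<exists>c\<in>A. p \<in> fst c"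
  using smooth_manifold unfolding smooth_manifold_def by blast

lemma is_chart: "c \<in> A \<Longrightarrow> is_chart M c"
  using smooth_manifold unfolding smooth_manifold_def by blast

lemma openin_chart: "c \<in> A \<Longrightarrow> openin M (fst c)"
  using is_chart unfolding is_chart_def by blast

lemma chart_topspace: "c \<in> A \<Longrightarrow> p \<in> fst c \<Longrightarrow> p \<in> topspace M"
  using openin_chart openin_subset by blast

lemma homeomorphic_chart:
  "c \<in> A \<Longrightarrow> homeomorphic_map (subtopology M (fst c)) (top_of_set (snd c ` fst c)) (snd c)"
  using is_chart unfolding is_chart_def by blast

lemma inj_on_chart: "c \<in> A \<Longrightarrow> inj_on (snd c) (fst c)"
  using homeomorphic_imp_injective_map[OF homeomorphic_chart] openin_subset[OF openin_chart]
  by (simp add: topspace_subtopology Int_absorb1)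

lemma chart_inv_chart [simp]: "c \<in> A \<Longrightarrow> p \<in> fst c \<Longrightarrow> chart_inv c (snd c p) = p"
  unfolding chart_inv_def by (rule inv_into_f_f[OF inj_on_chart])

lemma open_chart_image:
  assumes "c \<in> A" "openin M U"
  shows "open (snd c ` (U \<inter> fst c))"
proof -
  have "openin (subtopology M (fst c)) (U \<inter> fst c)"
    using assms(2) by (auto simp: openin_subtopology)
  then have "openin (top_of_set (snd c ` fst c)) (snd c ` (U \<inter> fst c))"
    using homeomorphic_imp_open_map[OF homeomorphic_chart[OF assms(1)]] unfolding open_map_def by blast
  moreover have "open (snd c ` fst c)" using is_chart[OF assms(1)] by (simp add: is_chart_def)
  ultimately show ?thesis using openin_open_eq by blast
qed

lemma open_chart_image_chart: "c \<in> A \<Longrightarrow> open (snd c ` fst c)"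
  using open_chart_image[of c "fst c"] openin_chart by simp

lemma open_chart_overlap: "c \<in> A \<Longrightarrow> d \<in> A \<Longrightarrow> open (snd c ` (fst c \<inter> fst d))"
  using open_chart_image[of c "fst d"] openin_chart by (simp add: Int_commute)

lemma continuous_map_chart_inv:
  assumes "c \<in> A"
  shows "continuous_map (top_of_set (snd c ` fst c)) M (chart_inv c)"
proof -
  have "{x \<in> snd c ` fst c. chart_inv c x \<in> U} = snd c ` (U \<inter> fst c)" for U
    using assms by auto
  moreover have "openin (top_of_set (snd c ` fst c)) (snd c ` (U \<inter> fst c))" if "openin M U" for U
    using open_chart_image[OF assms that] by (auto intro: open_subset)
  ultimately show ?thesis
    using assms chart_topspace[OF assms] by (auto simp: continuous_map_def)
qed

lemma smooth_on_transition:
  "c \<in> A \<Longrightarrow> d \<in> A \<Longrightarrow> smooth_on (snd c ` (fst c \<inter> fst d)) (snd d \<circ> chart_inv c)"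
  using smooth_manifold unfolding smooth_manifold_def by blast

abbreviation dtrans where
  "dtrans c d p \<equiv> frechet_derivative (snd d \<circ> chart_inv c) (at (snd c p))"

lemma has_derivative_transition:
  assumes "c \<in> A" "d \<in> A" "p \<in> fst c" "p \<in> fst d"
  shows "(snd d \<circ> chart_inv c has_derivative dtrans c d p) (at (snd c p))"
  using assms by (intro smooth_on_imp_has_derivative[OF smooth_on_transition]) auto

lemma linear_dtrans:
  "c \<in> A \<Longrightarrow> d \<in> A \<Longrightarrow> p \<in> fst c \<Longrightarrow> p \<in> fst d \<Longrightarrow> linear (dtrans c d p)"
  using has_derivative_transition has_derivative_linear by blast

lemma dtrans_self:
  assumes "c \<in> A" "p \<in> fst c"
  shows "dtrans c c p y = y"
proof -
  have "((\<lambda>x. x) has_derivative dtrans c c p) (at (snd c p))"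
    by (rule has_derivative_transform_within_open[OF has_derivative_transition[OF assms(1,1,2,2)]
        open_chart_image_chart[OF assms(1)]]) (use assms in auto)
  then have "dtrans c c p = (\<lambda>x. x)"
    using has_derivative_unique has_derivative_ident by blast
  then show ?thesis by simp
qed

text \<open>Chain rule: the composed transition agrees with the direct one near
  \<open>snd c p\<close>. This cocycle identity is what makes \<open>lift\<close> a tangent
  vector.\<close>

lemma dtrans_dtrans:
  assumes "c \<in> A" "d \<in> A" "e \<in> A" "p \<in> fst c" "p \<in> fst d" "p \<in> fst e"
  shows "dtrans d e p (dtrans c d p y) = dtrans c e p y"
proof -
  have "((snd e \<circ> chart_inv d) \<circ> (snd d \<circ> chart_inv c) has_derivative dtrans d e p \<circ> dtrans c d p)
      (at (snd c p))"
    by (rule diff_chain_at) (use assms has_derivative_transition in auto)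
  then have "(snd e \<circ> chart_inv c has_derivative dtrans d e p \<circ> dtrans c d p) (at (snd c p))"
    by (rule has_derivative_transform_within_open[OF _ open_chart_overlap[OF assms(1,2)]])
      (use assms in auto)
  then have "dtrans d e p \<circ> dtrans c d p = dtrans c e p"
    using has_derivative_unique has_derivative_transition assms by blast
  then show ?thesis by (metis comp_apply)
qed

subsection \<open>Tangent vectors\<close>

text \<open>Inverse of reading off the coordinates in the chart \<open>c\<close>. For fixed
  \<open>y\<close> it is a combination of the coordinate fields of \<open>c\<close> with constant
  coefficients. The default 0 is the convention of \<open>tangent_space\<close>.\<close>

definition lift :: "('m, 'e) chart \<Rightarrow> 'm \<Rightarrow> 'e \<Rightarrow> ('m, 'e) tvec" where
  "lift c p y = (\<lambda>d. if d \<in> A \<and> p \<in> fst d then dtrans c d p y else 0)"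

lemma lift_apply [simp]: "c \<in> A \<Longrightarrow> p \<in> fst c \<Longrightarrow> lift c p y c = y"
  by (simp add: lift_def dtrans_self)

lemma tangent_spaceD:
  assumes "v \<in> tangent_space A p"
  shows "c \<in> A \<Longrightarrow> d \<in> A \<Longrightarrow> p \<in> fst c \<Longrightarrow> p \<in> fst d \<Longrightarrow> v d = dtrans c d p (v c)"
    and "\<not> (d \<in> A \<and> p \<in> fst d) \<Longrightarrow> v d = 0"
  using assms unfolding tangent_space_def by blast+

lemma tangent_spaceI:
  assumes "\<And>c d. c \<in> A \<Longrightarrow> d \<in> A \<Longrightarrow> p \<in> fst c \<Longrightarrow> p \<in> fst d \<Longrightarrow> v d = dtrans c d p (v c)"
    and "\<And>d. \<not> (d \<in> A \<and> p \<in> fst d) \<Longrightarrow> v d = 0"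
  shows "v \<in> tangent_space A p"
  unfolding tangent_space_def using assms by blast

lemma lift_in_tangent_space:
  assumes "c \<in> A" "p \<in> fst c"
  shows "lift c p y \<in> tangent_space A p"
proof (rule tangent_spaceI)
  fix d e assume "d \<in> A" "e \<in> A" "p \<in> fst d" "p \<in> fst e"
  then show "lift c p y e = dtrans d e p (lift c p y d)"
    using dtrans_dtrans[of c d e p y] assms by (simp add: lift_def)
qed (auto simp: lift_def)

text \<open>The transition derivatives recover all coordinates from those in one chart, so an
  equality of tangent vectors becomes a single equation in \<open>'e\<close>.\<close>

lemma tangent_space_eqI:
  assumes "v \<in> tangent_space A p" "w \<in> tangent_space A p" "c \<in> A" "p \<in> fst c" "v c = w c"
  shows "v = w"
proof
  fix d
  show "v d = w d"
  proof (cases "d \<in> A \<and> p \<in> fst d")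
    case True
    then have "v d = dtrans c d p (v c)" "w d = dtrans c d p (w c)"
      by (simp_all add: tangent_spaceD(1)[OF assms(1,3)] tangent_spaceD(1)[OF assms(2,3)] assms(4))
    then show ?thesis by (simp only: assms(5))
  next
    case False
    then show ?thesis
      by (simp only: tangent_spaceD(2)[OF assms(1) False] tangent_spaceD(2)[OF assms(2) False])
  qed
qed

lemma subspace_tangent_space: "subspace (tangent_space A p)"
  unfolding subspace_def
proof (intro conjI ballI allI)
  show "0 \<in> tangent_space A p"
    by (rule tangent_spaceI) (simp_all add: linear_0[OF linear_dtrans])
  show "v + w \<in> tangent_space A p" if v: "v \<in> tangent_space A p" and w: "w \<in> tangent_space A p" for v w
  proof (rule tangent_spaceI)
    fix c d assume c: "c \<in> A" "d \<in> A" "p \<in> fst c" "p \<in> fst d"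
    have "v d = dtrans c d p (v c)" "w d = dtrans c d p (w c)"
      by (rule tangent_spaceD(1)[OF v c] tangent_spaceD(1)[OF w c])+
    then show "(v + w) d = dtrans c d p ((v + w) c)"
      by (simp only: plus_fun_apply linear_add[OF linear_dtrans[OF c]])
  qed (simp add: tangent_spaceD(2)[OF v] tangent_spaceD(2)[OF w])
  show "r *\<^sub>R v \<in> tangent_space A p" if v: "v \<in> tangent_space A p" for r v
  proof (rule tangent_spaceI)
    fix c d assume c: "c \<in> A" "d \<in> A" "p \<in> fst c" "p \<in> fst d"
    have "v d = dtrans c d p (v c)" by (rule tangent_spaceD(1)[OF v c])
    then show "(r *\<^sub>R v) d = dtrans c d p ((r *\<^sub>R v) c)"
      by (simp only: scaleR_fun_apply linear_scale[OF linear_dtrans[OF c]])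
  qed (simp add: tangent_spaceD(2)[OF v])
qed

lemmas tangent_zero = subspace_0[OF subspace_tangent_space]
  and tangent_add = subspace_add[OF subspace_tangent_space]
  and tangent_scale = subspace_scale[OF subspace_tangent_space]
  and tangent_diff = subspace_diff[OF subspace_tangent_space]
  and tangent_sum = subspace_sum[OF subspace_tangent_space]

subsection \<open>Smooth functions and vector fields\<close>

lemma smooth_fun_openin: "smooth_fun M A U f \<Longrightarrow> openin M U"
  by (simp add: smooth_fun_def)

lemma smooth_funI:
  "openin M U \<Longrightarrow> (\<And>c. c \<in> A \<Longrightarrow> smooth_on (snd c ` (U \<inter> fst c)) (\<lambda>x. f (chart_inv c x)))
    \<Longrightarrow> smooth_fun M A U f"
  by (simp add: smooth_fun_def comp_def)

lemma smooth_funD: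
  "smooth_fun M A U f \<Longrightarrow> c \<in> A \<Longrightarrow> smooth_on (snd c ` (U \<inter> fst c)) (\<lambda>x. f (chart_inv c x))"
  by (simp add: smooth_fun_def comp_def)

lemma smooth_fun_const: "openin M U \<Longrightarrow> smooth_fun M A U (\<lambda>_. r)"
  by (intro smooth_funI smooth_on_const)

lemma smooth_fun_mult:
  assumes "smooth_fun M A U f" "smooth_fun M A U g"
  shows "smooth_fun M A U (\<lambda>p. f p * g p)"
  using assms
  by (intro smooth_funI smooth_on_bilinear[OF open_chart_image bounded_bilinear_mult])
    (auto intro: smooth_fun_openin smooth_funD)

lemma smooth_fun_rsqrt:
  assumes "smooth_fun M A U f" "\<And>p. p \<in> U \<Longrightarrow> 0 < f p"
  shows "smooth_fun M A U (\<lambda>p. 1 / sqrt (f p))"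
proof (rule smooth_funI[OF smooth_fun_openin[OF assms(1)]])
  fix c assume c: "c \<in> A"
  have "smooth_on (snd c ` (U \<inter> fst c)) ((\<lambda>x. 1 / sqrt x) \<circ> (\<lambda>x. f (chart_inv c x)))"
    by (rule smooth_on_compose[OF open_chart_image[OF c smooth_fun_openin[OF assms(1)]]
          smooth_on_rsqrt smooth_funD[OF assms(1) c]]) (use c assms(2) in auto)
  then show "smooth_on (snd c ` (U \<inter> fst c)) (\<lambda>x. 1 / sqrt (f (chart_inv c x)))"
    by (simp add: comp_def)
qed

lemma smooth_vfield_openin: "smooth_vfield M A U X \<Longrightarrow> openin M U"
  by (simp add: smooth_vfield_def)

lemma smooth_vfield_tangent: "smooth_vfield M A U X \<Longrightarrow> p \<in> U \<Longrightarrow> X p \<in> tangent_space A p"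
  by (simp add: smooth_vfield_def)

lemma smooth_vfieldD:
  "smooth_vfield M A U X \<Longrightarrow> c \<in> A \<Longrightarrow> smooth_on (snd c ` (U \<inter> fst c)) (\<lambda>x. X (chart_inv c x) c)"
  by (simp add: smooth_vfield_def)

lemma smooth_vfield_subset:
  assumes "smooth_vfield M A U X" "openin M V" "V \<subseteq> U"
  shows "smooth_vfield M A V X"
  unfolding smooth_vfield_def
proof (intro conjI ballI)
  show "X p \<in> tangent_space A p" if "p \<in> V" for p
    using smooth_vfield_tangent[OF assms(1)] that assms(3) by blast
  show "smooth_on (snd c ` (V \<inter> fst c)) (\<lambda>x. X (chart_inv c x) c)" if "c \<in> A" for c
    by (rule smooth_on_subset[OF smooth_vfieldD[OF assms(1) that]]) (use assms(3) in blast)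
qed (rule assms(2))

lemma smooth_vfield_cong:
  assumes "smooth_vfield M A U X" "\<And>p. p \<in> U \<Longrightarrow> X p = Y p"
  shows "smooth_vfield M A U Y"
  unfolding smooth_vfield_def
proof (intro conjI ballI)
  show U: "openin M U" by (rule smooth_vfield_openin[OF assms(1)])
  show "Y p \<in> tangent_space A p" if "p \<in> U" for p
    using smooth_vfield_tangent[OF assms(1) that] assms(2)[OF that] by simp
  show "smooth_on (snd c ` (U \<inter> fst c)) (\<lambda>x. Y (chart_inv c x) c)" if "c \<in> A" for c
    by (rule smooth_on_cong[OF open_chart_image[OF that U] _ smooth_vfieldD[OF assms(1) that]])
      (use assms(2) that in auto)
qed

lemma smooth_vfield_local:
  assumes "openin M U" "\<And>p. p \<in> U \<Longrightarrow> \<exists>V. p \<in> V \<and> smooth_vfield M A V X"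
  shows "smooth_vfield M A U X"
  unfolding smooth_vfield_def
proof (intro conjI ballI)
  show "X p \<in> tangent_space A p" if "p \<in> U" for p
    using assms(2)[OF that] smooth_vfield_tangent by blast
  show "smooth_on (snd c ` (U \<inter> fst c)) (\<lambda>x. X (chart_inv c x) c)" if c: "c \<in> A" for c
  proof (rule smooth_on_open_cover)
    fix x assume "x \<in> snd c ` (U \<inter> fst c)"
    then obtain p where p: "p \<in> U" "p \<in> fst c" "x = snd c p" by auto
    then obtain V where "p \<in> V" "smooth_vfield M A V X" using assms(2) by blast
    then show "\<exists>T. open T \<and> x \<in> T \<and> smooth_on T (\<lambda>x. X (chart_inv c x) c)"
      using p c smooth_vfieldD open_chart_image smooth_vfield_openin
      by (intro exI[of _ "snd c ` (V \<inter> fst c)"]) auto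
  qed
qed (rule assms(1))

lemma smooth_vfield_add:
  assumes "smooth_vfield M A U X" "smooth_vfield M A U Y"
  shows "smooth_vfield M A U (\<lambda>p. X p + Y p)"
  unfolding smooth_vfield_def
proof (intro conjI ballI)
  show U: "openin M U" by (rule smooth_vfield_openin[OF assms(1)])
  show "X p + Y p \<in> tangent_space A p" if "p \<in> U" for p
    by (intro tangent_add smooth_vfield_tangent[OF assms(1) that] smooth_vfield_tangent[OF assms(2) that])
  show "smooth_on (snd c ` (U \<inter> fst c)) (\<lambda>x. (X (chart_inv c x) + Y (chart_inv c x)) c)" if "c \<in> A" for c
    unfolding plus_fun_apply
    by (intro smooth_on_add open_chart_image smooth_vfieldD assms U that)
qed

lemma smooth_vfield_scale:
  assumes "smooth_fun M A U f" "smooth_vfield M A U X"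
  shows "smooth_vfield M A U (\<lambda>p. f p *\<^sub>R X p)"
  unfolding smooth_vfield_def
proof (intro conjI ballI)
  show U: "openin M U" by (rule smooth_vfield_openin[OF assms(2)])
  show "f p *\<^sub>R X p \<in> tangent_space A p" if "p \<in> U" for p
    by (intro tangent_scale smooth_vfield_tangent[OF assms(2) that])
  show "smooth_on (snd c ` (U \<inter> fst c)) (\<lambda>x. (f (chart_inv c x) *\<^sub>R X (chart_inv c x)) c)" if "c \<in> A" for c
    unfolding scaleR_fun_apply
    by (intro smooth_on_bilinear[OF _ bounded_bilinear_scaleR] open_chart_image smooth_vfieldD smooth_funD assms U that)
qed

lemma smooth_vfield_zero: "openin M U \<Longrightarrow> smooth_vfield M A U (\<lambda>p. 0)"
  unfolding smooth_vfield_def by (simp add: tangent_zero smooth_on_const)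

lemma smooth_vfield_sum:
  "openin M U \<Longrightarrow> (\<And>i. i \<in> I \<Longrightarrow> smooth_vfield M A U (X i)) \<Longrightarrow> smooth_vfield M A U (\<lambda>p. \<Sum>i\<in>I. X i p)"
  by (induction I rule: infinite_finite_induct) (auto intro: smooth_vfield_zero smooth_vfield_add)

lemma smooth_vfield_diff:
  assumes "smooth_vfield M A U X" "smooth_vfield M A U Y"
  shows "smooth_vfield M A U (\<lambda>p. X p - Y p)"
proof -
  have "smooth_vfield M A U (\<lambda>p. X p + (- 1) *\<^sub>R Y p)"
    by (intro smooth_vfield_add smooth_vfield_scale smooth_fun_const smooth_vfield_openin[OF assms(1)] assms)
  then show ?thesis by simp
qed

text \<open>In another chart \<open>d\<close> the coordinates are the derivative of the transition
  from \<open>c\<close> to \<open>d\<close> in the constant direction \<open>y\<close>, evaluated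
  after the transition from \<open>d\<close> to \<open>c\<close>.\<close>

lemma smooth_vfield_lift:
  assumes c: "c \<in> A"
  shows "smooth_vfield M A (fst c) (\<lambda>p. lift c p y)"
  unfolding smooth_vfield_def
proof (intro conjI ballI)
  show "openin M (fst c)" by (rule openin_chart[OF c])
  show "lift c p y \<in> tangent_space A p" if "p \<in> fst c" for p
    by (rule lift_in_tangent_space[OF c that])
  fix d assume d: "d \<in> A"
  let ?S = "snd d ` (fst c \<inter> fst d)"
  have S: "open ?S" by (rule open_chart_image[OF d openin_chart[OF c]])
  have "smooth_on ?S ((\<lambda>z. frechet_derivative (snd d \<circ> chart_inv c) (at z) y) \<circ> (snd c \<circ> chart_inv d))"
  proof (rule smooth_on_compose[OF S])
    show "smooth_on (snd c ` (fst c \<inter> fst d)) (\<lambda>z. frechet_derivative (snd d \<circ> chart_inv c) (at z) y)"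
      by (rule smooth_on_frechet_derivative[OF smooth_on_transition[OF c d]])
    show "smooth_on ?S (snd c \<circ> chart_inv d)"
      using smooth_on_transition[OF d c] by (simp add: Int_commute)
  qed (use c d in auto)
  then show "smooth_on ?S (\<lambda>x. lift c (chart_inv d x) y d)"
    by (rule smooth_on_cong[OF S, rotated]) (use c d in \<open>auto simp: lift_def\<close>)
qed

lemma dir_deriv_const:
  assumes "openin M U" "p \<in> U" "\<And>q. q \<in> U \<Longrightarrow> f q = r"
  shows "dir_deriv A p v f = 0"
proof -
  \<comment> \<open>Differentiation takes place in the very chart that \<open>dir_deriv\<close>
    chooses, so its independence of the chart does not have to be invoked.\<close>
  define c where "c = (SOME c. c \<in> A \<and> p \<in> fst c)"
  have "\<exists>c. c \<in> A \<and> p \<in> fst c" using chart_exists assms openin_subset by blast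
  then have c: "c \<in> A" "p \<in> fst c" unfolding c_def by (metis (mono_tags, lifting) someI_ex)+
  have "(f \<circ> chart_inv c has_derivative (\<lambda>_. 0)) (at (snd c p))"
    by (rule has_derivative_transform_within_open[OF has_derivative_const[of r] open_chart_image[OF c(1) assms(1)]])
      (use c assms in auto)
  then have "frechet_derivative (f \<circ> chart_inv c) (at (snd c p)) = (\<lambda>_. 0)"
    using frechet_derivative_at by metis
  then show ?thesis by (simp add: dir_deriv_def c_def[symmetric] Let_def)
qed

subsection \<open>Curves\<close>

lemma open_curve_preimage:
  assumes "smooth_curve M A I \<gamma>" "openin M U"
  shows "open {t \<in> I. \<gamma> t \<in> U}"
proof -
  have "openin (top_of_set I) {t \<in> I. \<gamma> t \<in> U}"
    using assms unfolding smooth_curve_def continuous_map_def by simp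
  then show ?thesis
    using assms(1) openin_open_trans unfolding smooth_curve_def by blast
qed

lemma curve_in_topspace: "smooth_curve M A I \<gamma> \<Longrightarrow> t \<in> I \<Longrightarrow> \<gamma> t \<in> topspace M"
  unfolding smooth_curve_def continuous_map_def by auto

lemma curve_has_vector_derivative:
  assumes "smooth_curve M A I \<gamma>" "t \<in> I" "c \<in> A" "\<gamma> t \<in> fst c"
  shows "(snd c \<circ> \<gamma> has_vector_derivative velocity A \<gamma> t c) (at t)"
proof -
  have "smooth_on {t \<in> I. \<gamma> t \<in> fst c} (snd c \<circ> \<gamma>)"
    using assms unfolding smooth_curve_def by blast
  then have "snd c \<circ> \<gamma> differentiable (at t)"
    using smooth_on_imp_has_derivative assms unfolding differentiable_def by blast
  then show ?thesis
    using assms by (simp add: velocity_def vector_derivative_works)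
qed

lemma velocity_in_tangent_space:
  assumes "smooth_curve M A I \<gamma>" "t \<in> I"
  shows "velocity A \<gamma> t \<in> tangent_space A (\<gamma> t)"
proof (rule tangent_spaceI)
  fix c d assume c: "c \<in> A" and d: "d \<in> A" and t: "\<gamma> t \<in> fst c" "\<gamma> t \<in> fst d"
  have "((snd d \<circ> chart_inv c) \<circ> (snd c \<circ> \<gamma>) has_vector_derivative dtrans c d (\<gamma> t) (velocity A \<gamma> t c)) (at t)"
    using vector_derivative_diff_chain_within[OF curve_has_vector_derivative[OF assms c t(1)],
        of "snd d \<circ> chart_inv c" "dtrans c d (\<gamma> t)"] has_derivative_transition[OF c d t]
    by (simp add: has_derivative_at_withinI)
  then have "(snd d \<circ> \<gamma> has_vector_derivative dtrans c d (\<gamma> t) (velocity A \<gamma> t c)) (at t)"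
    by (rule has_vector_derivative_transform_within_open[OF _ open_curve_preimage[OF assms(1) openin_chart[OF c]]])
      (use assms t c in auto)
  then show "velocity A \<gamma> t d = dtrans c d (\<gamma> t) (velocity A \<gamma> t c)"
    using curve_has_vector_derivative[OF assms d t(2)] vector_derivative_unique_at by blast
qed (auto simp: velocity_def)

lemma has_real_derivative_along_curve:
  assumes \<gamma>: "smooth_curve M A I \<gamma>" "t \<in> I" and f: "smooth_fun M A U f" "\<gamma> t \<in> U"
  shows "((\<lambda>s. f (\<gamma> s)) has_real_derivative dir_deriv A (\<gamma> t) (velocity A \<gamma> t) f) (at t)"
proof -
  define c where "c = (SOME c. c \<in> A \<and> \<gamma> t \<in> fst c)"
  have "\<exists>c. c \<in> A \<and> \<gamma> t \<in> fst c" using chart_exists curve_in_topspace[OF \<gamma>] by blast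
  then have c: "c \<in> A" "\<gamma> t \<in> fst c" unfolding c_def by (metis (mono_tags, lifting) someI_ex)+
  let ?D = "frechet_derivative (f \<circ> chart_inv c) (at (snd c (\<gamma> t)))"
  have "smooth_on (snd c ` (U \<inter> fst c)) (f \<circ> chart_inv c)"
    using f c unfolding smooth_fun_def by blast
  then have "(f \<circ> chart_inv c has_derivative ?D) (at (snd c (\<gamma> t)))"
    using f c by (intro smooth_on_imp_has_derivative) auto
  then have "((f \<circ> chart_inv c) \<circ> (snd c \<circ> \<gamma>) has_vector_derivative ?D (velocity A \<gamma> t c)) (at t)"
    using vector_derivative_diff_chain_within[OF curve_has_vector_derivative[OF \<gamma> c], of "f \<circ> chart_inv c" ?D]
    by (simp add: has_derivative_at_withinI)
  then have "((\<lambda>s. f (\<gamma> s)) has_vector_derivative ?D (velocity A \<gamma> t c)) (at t)"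
    by (rule has_vector_derivative_transform_within_open[OF _ open_curve_preimage[OF \<gamma>(1) openin_chart[OF c(1)]]])
      (use \<gamma> c in auto)
  then show ?thesis
    by (simp add: dir_deriv_def c_def[symmetric] Let_def has_real_derivative_iff_has_vector_derivative)
qed

end

section \<open>Orthonormal frames\<close>

locale riemannian_manifold = manifold M A
  for M :: "'m topology" and A :: "('m, 'e::euclidean_space) chart set" +
  fixes \<alpha> :: "'m \<Rightarrow> ('m, 'e) tvec \<Rightarrow> ('m, 'e) tvec \<Rightarrow> real"
  assumes riemannian: "riemannian_metric M A \<alpha>"
begin

lemma metric_smooth:
  "smooth_vfield M A U X \<Longrightarrow> smooth_vfield M A U Y \<Longrightarrow> smooth_fun M A U (\<lambda>p. \<alpha> p (X p) (Y p))"
  using riemannian unfolding riemannian_metric_def by simp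

context
  fixes p assumes p: "p \<in> topspace M"
begin

lemma metric_sym: "v \<in> tangent_space A p \<Longrightarrow> w \<in> tangent_space A p \<Longrightarrow> \<alpha> p v w = \<alpha> p w v"
  using riemannian p unfolding riemannian_metric_def by blast

lemma metric_pos: "v \<in> tangent_space A p \<Longrightarrow> v \<noteq> 0 \<Longrightarrow> 0 < \<alpha> p v v"
  using riemannian p unfolding riemannian_metric_def by blast

lemma bilinear_metric: "bilinear_on (tangent_space A p) (\<alpha> p)"
  using riemannian p unfolding riemannian_metric_def by blast

lemma metric_add_left:
  "u \<in> tangent_space A p \<Longrightarrow> v \<in> tangent_space A p \<Longrightarrow> w \<in> tangent_space A p \<Longrightarrow>
    \<alpha> p (u + v) w = \<alpha> p u w + \<alpha> p v w"
  using bilinear_metric unfolding bilinear_on_def linear_on_def by blast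

lemma metric_add_right:
  "u \<in> tangent_space A p \<Longrightarrow> v \<in> tangent_space A p \<Longrightarrow> w \<in> tangent_space A p \<Longrightarrow>
    \<alpha> p w (u + v) = \<alpha> p w u + \<alpha> p w v"
  using bilinear_metric unfolding bilinear_on_def linear_on_def by blast

lemma metric_scale_left:
  assumes "v \<in> tangent_space A p" "w \<in> tangent_space A p"
  shows "\<alpha> p (r *\<^sub>R v) w = r * \<alpha> p v w"
proof -
  have "\<alpha> p (r *\<^sub>R v) w = r *\<^sub>R \<alpha> p v w"
    using bilinear_metric assms unfolding bilinear_on_def linear_on_def by blast
  then show ?thesis by simp
qed

lemma metric_scale_right:
  assumes "v \<in> tangent_space A p" "w \<in> tangent_space A p"
  shows "\<alpha> p w (r *\<^sub>R v) = r * \<alpha> p w v"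
proof -
  have "\<alpha> p w (r *\<^sub>R v) = r *\<^sub>R \<alpha> p w v"
    using bilinear_metric assms unfolding bilinear_on_def linear_on_def by blast
  then show ?thesis by simp
qed

lemma metric_zero_left: "w \<in> tangent_space A p \<Longrightarrow> \<alpha> p 0 w = 0"
  using metric_scale_left[of w w 0] by simp

lemma metric_zero_right: "w \<in> tangent_space A p \<Longrightarrow> \<alpha> p w 0 = 0"
  using metric_scale_right[of w w 0] by simp

lemma metric_diff_left:
  assumes "u \<in> tangent_space A p" "v \<in> tangent_space A p" "w \<in> tangent_space A p"
  shows "\<alpha> p (u - v) w = \<alpha> p u w - \<alpha> p v w"
  using metric_add_left[of "u - v" v w] assms tangent_diff[of u p v] by simp

lemma metric_sum_left:
  assumes "w \<in> tangent_space A p"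
  shows "(\<And>i. i \<in> I \<Longrightarrow> v i \<in> tangent_space A p) \<Longrightarrow> \<alpha> p (\<Sum>i\<in>I. v i) w = (\<Sum>i\<in>I. \<alpha> p (v i) w)"
proof (induction I rule: infinite_finite_induct)
  case (insert i I)
  have "\<alpha> p (v i + sum v I) w = \<alpha> p (v i) w + \<alpha> p (sum v I) w"
    using insert.prems assms by (intro metric_add_left tangent_sum) auto
  then show ?case
    using insert by (simp only: sum.insert[OF insert.hyps]) simp
qed (simp_all add: metric_zero_left assms)

lemma metric_sum_right:
  assumes "w \<in> tangent_space A p" "\<And>i. i \<in> I \<Longrightarrow> v i \<in> tangent_space A p"
  shows "\<alpha> p w (\<Sum>i\<in>I. v i) = (\<Sum>i\<in>I. \<alpha> p w (v i))"
proof -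
  have "\<alpha> p w (\<Sum>i\<in>I. v i) = \<alpha> p (\<Sum>i\<in>I. v i) w" using assms by (intro metric_sym tangent_sum)
  also have "\<dots> = (\<Sum>i\<in>I. \<alpha> p (v i) w)" by (rule metric_sum_left[OF assms])
  also have "\<dots> = (\<Sum>i\<in>I. \<alpha> p w (v i))" using assms by (intro sum.cong refl metric_sym)
  finally show ?thesis .
qed

lemma metric_eq_zeroD: "v \<in> tangent_space A p \<Longrightarrow> \<alpha> p v v = 0 \<Longrightarrow> v = 0"
  using metric_pos[of v] by (cases "v = 0") auto

end

lemma smooth_vfield_topspace: "smooth_vfield M A U X \<Longrightarrow> p \<in> U \<Longrightarrow> p \<in> topspace M"
  using smooth_vfield_openin openin_subset by blast

text \<open>The process runs at all points of the chart at once, starting from the fields of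
  constant coordinates. Its coefficients are products under \<open>\<alpha>\<close> and reciprocal
  square roots of positive functions, so smoothness persists. The span clause is the invariant that
  keeps the next field from vanishing.\<close>

lemma gram_schmidt:
  assumes c: "c \<in> A"
  shows "finite S \<Longrightarrow> S \<subseteq> Basis \<Longrightarrow> \<exists>e :: 'e \<Rightarrow> ('m, 'e) vfield. (\<forall>i\<in>S. smooth_vfield M A (fst c) (e i)) \<and>
    (\<forall>p\<in>fst c. \<forall>i\<in>S. e i p c \<in> span S \<and> (\<forall>j\<in>S. \<alpha> p (e i p) (e j p) = (if i = j then 1 else 0)))"
proof (induction S rule: finite_induct)
  case empty
  show ?case by simp
next
  case (insert i S)
  then obtain e :: "'e \<Rightarrow> ('m, 'e) vfield" where e: "\<And>j. j \<in> S \<Longrightarrow> smooth_vfield M A (fst c) (e j)"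
    and e_span: "\<And>p j. p \<in> fst c \<Longrightarrow> j \<in> S \<Longrightarrow> e j p c \<in> span S"
    and e_on: "\<And>p j k. p \<in> fst c \<Longrightarrow> j \<in> S \<Longrightarrow> k \<in> S \<Longrightarrow> \<alpha> p (e j p) (e k p) = (if j = k then 1 else 0)"
    by (metis insert_subset)
  define E where "E p = lift c p i" for p
  have E: "smooth_vfield M A (fst c) E" unfolding E_def by (rule smooth_vfield_lift[OF c])
  define f where "f p = E p - (\<Sum>j\<in>S. \<alpha> p (E p) (e j p) *\<^sub>R e j p)" for p
  have f: "smooth_vfield M A (fst c) f"
    unfolding f_def[abs_def]
    by (intro smooth_vfield_diff smooth_vfield_sum smooth_vfield_scale metric_smooth E e openin_chart c)
  have f_orth: "\<alpha> p (f p) (e k p) = 0" if p: "p \<in> fst c" and k: "k \<in> S" for p k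
  proof -
    note top = chart_topspace[OF c p]
    note T = smooth_vfield_tangent[OF e p] smooth_vfield_tangent[OF E p]
    have "\<alpha> p (\<Sum>j\<in>S. \<alpha> p (E p) (e j p) *\<^sub>R e j p) (e k p) = (\<Sum>j\<in>S. \<alpha> p (E p) (e j p) * \<alpha> p (e j p) (e k p))"
      using k by (simp add: metric_sum_left[OF top] metric_scale_left[OF top] T tangent_scale)
    also have "\<dots> = (\<Sum>j\<in>S. if j = k then \<alpha> p (E p) (e j p) else 0)"
      by (rule sum.cong) (use p k e_on in auto)
    also have "\<dots> = \<alpha> p (E p) (e k p)" using insert.hyps(1) k by simp
    finally show ?thesis
      unfolding f_def using k by (simp add: metric_diff_left[OF top] T tangent_sum tangent_scale)
  qed
  have f_span: "f p c \<in> span (insert i S)" and f_nz: "f p \<noteq> 0" if p: "p \<in> fst c" for p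
  proof -
    have fp: "f p c = i - (\<Sum>j\<in>S. \<alpha> p (E p) (e j p) *\<^sub>R e j p c)"
      using c p by (simp add: f_def E_def sum_fun_apply)
    have sum: "(\<Sum>j\<in>S. \<alpha> p (E p) (e j p) *\<^sub>R e j p c) \<in> span S"
      using e_span p by (intro span_sum span_scale) auto
    have "span S \<subseteq> span (insert i S)" by (rule span_mono) auto
    then have "(\<Sum>j\<in>S. \<alpha> p (E p) (e j p) *\<^sub>R e j p c) \<in> span (insert i S)" using sum by blast
    moreover have "i \<in> span (insert i S)" by (rule span_base) simp
    ultimately show "f p c \<in> span (insert i S)"
      unfolding fp by (intro span_diff)
    \<comment> \<open>The sum subtracted from \<open>i\<close> lies in \<open>span S\<close>, so
      \<open>f p\<close> could vanish only if \<open>i\<close> did too.\<close>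
    have "i \<notin> span S"
    proof -
      have "S \<subseteq> Basis - {i}" using insert by auto
      then have "span S \<subseteq> span (Basis - {i})" by (rule span_mono)
      moreover have "i \<notin> span (Basis - {i})"
        using independent_Basis insert.prems unfolding dependent_def by blast
      ultimately show ?thesis by blast
    qed
    then show "f p \<noteq> 0" using sum fp by auto
  qed
  have f_pos: "0 < \<alpha> p (f p) (f p)" if p: "p \<in> fst c" for p
    by (rule metric_pos[OF chart_topspace[OF c p] smooth_vfield_tangent[OF f p] f_nz[OF p]])
  define g where "g p = (1 / sqrt (\<alpha> p (f p) (f p))) *\<^sub>R f p" for p
  have g: "smooth_vfield M A (fst c) g"
    unfolding g_def[abs_def]
    by (intro smooth_vfield_scale smooth_fun_rsqrt metric_smooth f f_pos)
  have g_orth: "\<alpha> p (g p) (e k p) = 0" "\<alpha> p (e k p) (g p) = 0" if p: "p \<in> fst c" and k: "k \<in> S" for p k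
  proof -
    note top = chart_topspace[OF c p]
    note T = smooth_vfield_tangent[OF e[OF k] p] smooth_vfield_tangent[OF f p]
    show 1: "\<alpha> p (g p) (e k p) = 0"
      unfolding g_def by (simp add: metric_scale_left[OF top] T f_orth p k)
    show "\<alpha> p (e k p) (g p) = 0"
      using metric_sym[OF top T(1) smooth_vfield_tangent[OF g p]] 1 by simp
  qed
  have g_norm: "\<alpha> p (g p) (g p) = 1" if p: "p \<in> fst c" for p
  proof -
    note top = chart_topspace[OF c p]
    note T = smooth_vfield_tangent[OF f p]
    have "\<alpha> p (g p) (g p) = (1 / sqrt (\<alpha> p (f p) (f p))) * ((1 / sqrt (\<alpha> p (f p) (f p))) * \<alpha> p (f p) (f p))"
      unfolding g_def by (simp add: metric_scale_left[OF top] metric_scale_right[OF top] T tangent_scale)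
    then show ?thesis using f_pos[OF p] by simp
  qed
  have g_span: "g p c \<in> span (insert i S)" if "p \<in> fst c" for p
    using f_span[OF that] by (simp add: g_def span_scale)
  have S_sub: "span S \<subseteq> span (insert i S)" by (rule span_mono) auto
  have ne: "j \<noteq> i" if "j \<in> S" for j using that insert.hyps(2) by auto
  show ?case
  proof (intro exI[of _ "e(i := g)"] conjI ballI)
    fix j assume "j \<in> insert i S"
    then show "smooth_vfield M A (fst c) ((e(i := g)) j)" using g e by auto
  next
    fix p j assume p: "p \<in> fst c" and "j \<in> insert i S"
    then show "(e(i := g)) j p c \<in> span (insert i S)" using g_span e_span S_sub by auto
  next
    fix p j k assume p: "p \<in> fst c" and "j \<in> insert i S" "k \<in> insert i S"
    then show "\<alpha> p ((e(i := g)) j p) ((e(i := g)) k p) = (if j = k then 1 else 0)"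
      using g_orth[OF p] g_norm[OF p] e_on[OF p] ne by auto
  qed
qed

definition orthonormal_frame :: "'m set \<Rightarrow> ('e \<Rightarrow> ('m, 'e) vfield) \<Rightarrow> bool" where
  "orthonormal_frame U e \<longleftrightarrow> (\<forall>i\<in>Basis. smooth_vfield M A U (e i)) \<and>
    (\<forall>p\<in>U. \<forall>i\<in>Basis. \<forall>j\<in>Basis. \<alpha> p (e i p) (e j p) = (if i = j then 1 else 0))"

lemma orthonormal_frame_exists: "c \<in> A \<Longrightarrow> \<exists>e. orthonormal_frame (fst c) e"
  using gram_schmidt[OF _ finite_Basis order_refl] unfolding orthonormal_frame_def by blast

text \<open>Over an orthonormal frame this is the linear isometry of \<open>'e\<close> onto the
  tangent space that takes the standard basis to the frame.\<close>

definition frame_map :: "('e \<Rightarrow> ('m, 'e) vfield) \<Rightarrow> 'm \<Rightarrow> 'e \<Rightarrow> ('m, 'e) tvec" where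
  "frame_map e p y = (\<Sum>i\<in>Basis. (y \<bullet> i) *\<^sub>R e i p)"

lemma frame_smooth: "orthonormal_frame U e \<Longrightarrow> i \<in> Basis \<Longrightarrow> smooth_vfield M A U (e i)"
  by (simp add: orthonormal_frame_def)

context
  fixes U e p assumes frame: "orthonormal_frame U e" and p: "p \<in> U"
begin

lemma frame_topspace: "p \<in> topspace M"
  using smooth_vfield_topspace[OF frame_smooth[OF frame SOME_Basis] p] .

lemma frame_tangent: "i \<in> Basis \<Longrightarrow> e i p \<in> tangent_space A p"
  by (rule smooth_vfield_tangent[OF frame_smooth[OF frame] p])

lemma frame_orthonormal:
  "i \<in> Basis \<Longrightarrow> j \<in> Basis \<Longrightarrow> \<alpha> p (e i p) (e j p) = (if i = j then 1 else 0)"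
  using frame p by (simp add: orthonormal_frame_def)

lemma frame_map_tangent: "frame_map e p y \<in> tangent_space A p"
  unfolding frame_map_def by (intro tangent_sum tangent_scale frame_tangent)

lemma metric_frame_map_frame:
  assumes "j \<in> Basis"
  shows "\<alpha> p (frame_map e p y) (e j p) = y \<bullet> j"
proof -
  have "\<alpha> p (frame_map e p y) (e j p) = (\<Sum>i\<in>Basis. (y \<bullet> i) * \<alpha> p (e i p) (e j p))"
    unfolding frame_map_def using assms
    by (simp add: metric_sum_left[OF frame_topspace] metric_scale_left[OF frame_topspace]
        frame_tangent tangent_scale)
  also have "\<dots> = (\<Sum>i\<in>Basis. if i = j then y \<bullet> i else 0)"
    by (rule sum.cong) (use assms frame_orthonormal in auto)
  finally show ?thesis using assms by simp
qed

lemma metric_frame_map: "\<alpha> p (frame_map e p y) (frame_map e p z) = y \<bullet> z"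
proof -
  have "\<alpha> p (frame_map e p y) (frame_map e p z)
      = (\<Sum>j\<in>Basis. (z \<bullet> j) * \<alpha> p (frame_map e p y) (e j p))"
    unfolding frame_map_def[of e p z]
    by (simp add: metric_sum_right[OF frame_topspace] metric_scale_right[OF frame_topspace]
        frame_tangent tangent_scale frame_map_tangent)
  also have "\<dots> = (\<Sum>j\<in>Basis. (y \<bullet> j) * (z \<bullet> j))"
    by (rule sum.cong) (simp_all add: metric_frame_map_frame)
  finally show ?thesis by (simp add: euclidean_inner[of y z])
qed

text \<open>Read in one chart, \<open>frame_map\<close> is an endomorphism of the finite-dimensional
  space \<open>'e\<close>. It is injective because it preserves inner products, hence
  surjective.\<close>

lemma frame_map_surj:
  assumes v: "v \<in> tangent_space A p"
  shows "\<exists>y. v = frame_map e p y"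
proof -
  obtain c where c: "c \<in> A" "p \<in> fst c" using chart_exists[OF frame_topspace] by blast
  have lin: "linear (\<lambda>y. frame_map e p y c)"
    unfolding frame_map_def sum_fun_apply
    by (auto intro!: linear_compose_sum linearI simp: inner_add_left scaleR_add_left)
  have "y = 0" if "frame_map e p y c = 0" for y
  proof -
    have "frame_map e p y = 0"
      by (rule tangent_space_eqI[OF frame_map_tangent tangent_zero c]) (use that in simp)
    then have "y \<bullet> y = 0"
      using metric_frame_map[of y y] metric_zero_left[OF frame_topspace tangent_zero] by simp
    then show ?thesis by simp
  qed
  then have "inj (\<lambda>y. frame_map e p y c)"
    using linear_injective_0[OF lin] by blast
  then have "surj (\<lambda>y. frame_map e p y c)"
    using linear_injective_imp_surjective[OF lin] by blast
  then obtain y where "v c = frame_map e p y c" by (metis surjD)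
  then have "v = frame_map e p y" by (rule tangent_space_eqI[OF v frame_map_tangent c])
  then show ?thesis ..
qed

lemma frame_expansion:
  assumes v: "v \<in> tangent_space A p"
  shows "v = (\<Sum>i\<in>Basis. \<alpha> p v (e i p) *\<^sub>R e i p)"
proof -
  obtain y where y: "v = frame_map e p y" using frame_map_surj[OF v] by blast
  have "(\<Sum>i\<in>Basis. \<alpha> p v (e i p) *\<^sub>R e i p) = (\<Sum>i\<in>Basis. (y \<bullet> i) *\<^sub>R e i p)"
    by (rule sum.cong) (simp_all add: y metric_frame_map_frame)
  then show ?thesis by (simp add: y frame_map_def)
qed

lemma orthonormal_basis_frame: "orthonormal_basis A \<alpha> p ((\<lambda>i. e i p) ` Basis)"
  unfolding orthonormal_basis_def
proof (intro conjI ballI)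
  show "span ((\<lambda>i. e i p) ` Basis) = tangent_space A p"
  proof
    show "span ((\<lambda>i. e i p) ` Basis) \<subseteq> tangent_space A p"
      by (rule span_minimal[OF _ subspace_tangent_space]) (auto intro: frame_tangent)
    show "tangent_space A p \<subseteq> span ((\<lambda>i. e i p) ` Basis)"
    proof
      fix v assume "v \<in> tangent_space A p"
      then have "v = (\<Sum>i\<in>Basis. \<alpha> p v (e i p) *\<^sub>R e i p)" by (rule frame_expansion)
      also have "\<dots> \<in> span ((\<lambda>i. e i p) ` Basis)"
        by (intro span_sum span_scale span_base) auto
      finally show "v \<in> span ((\<lambda>i. e i p) ` Basis)" .
    qed
  qed
  \<comment> \<open>\<open>orthonormal_basis\<close> compares vectors whereas the frame compares
    indices, so distinct indices must be shown to give distinct vectors.\<close>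
  have ne: "e i p \<noteq> e j p" if "i \<in> Basis" "j \<in> Basis" "i \<noteq> j" for i j
    using frame_orthonormal[of i j] frame_orthonormal[of i i] that by auto
  fix v w assume "v \<in> (\<lambda>i. e i p) ` Basis" "w \<in> (\<lambda>i. e i p) ` Basis"
  then show "\<alpha> p v w = (if v = w then 1 else 0)" using ne frame_orthonormal by auto
qed simp

end

lemma orthonormal_basis_exists: "p \<in> topspace M \<Longrightarrow> \<exists>B. orthonormal_basis A \<alpha> p B"
  using chart_exists orthonormal_frame_exists orthonormal_basis_frame by blast

end

section \<open>The dual vector field\<close>

locale metric_one_form = riemannian_manifold M A \<alpha>
  for M :: "'m topology" and A :: "('m, 'e::euclidean_space) chart set" and \<alpha> +
  fixes \<beta> :: "'m \<Rightarrow> ('m, 'e) tvec \<Rightarrow> real"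
  assumes one_form: "one_form M A \<beta>"
begin

lemma form_linear_on: "p \<in> topspace M \<Longrightarrow> linear_on (tangent_space A p) (\<beta> p)"
  using one_form unfolding one_form_def by blast

lemma form_add:
  "p \<in> topspace M \<Longrightarrow> u \<in> tangent_space A p \<Longrightarrow> v \<in> tangent_space A p \<Longrightarrow> \<beta> p (u + v) = \<beta> p u + \<beta> p v"
  using form_linear_on unfolding linear_on_def by blast

lemma form_scale:
  assumes "p \<in> topspace M" "v \<in> tangent_space A p"
  shows "\<beta> p (r *\<^sub>R v) = r * \<beta> p v"
proof -
  have "\<beta> p (r *\<^sub>R v) = r *\<^sub>R \<beta> p v" using form_linear_on assms unfolding linear_on_def by blast
  then show ?thesis by simp
qed

lemma form_sum:
  assumes "p \<in> topspace M"
  shows "(\<And>i. i \<in> I \<Longrightarrow> v i \<in> tangent_space A p) \<Longrightarrow> \<beta> p (\<Sum>i\<in>I. v i) = (\<Sum>i\<in>I. \<beta> p (v i))"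
proof (induction I rule: infinite_finite_induct)
  case (insert i I)
  have "\<beta> p (v i + sum v I) = \<beta> p (v i) + \<beta> p (sum v I)"
    using insert.prems assms by (intro form_add tangent_sum) auto
  then show ?case
    using insert by (simp only: sum.insert[OF insert.hyps]) simp
qed (use form_scale[OF assms tangent_zero, of 0] in simp_all)

lemma form_smooth: "smooth_vfield M A U X \<Longrightarrow> smooth_fun M A U (\<lambda>p. \<beta> p (X p))"
  using one_form unfolding one_form_def by blast

text \<open>Expanding \<open>v\<close> in the frame shows that the sum represents
  \<open>\<beta>\<close>, and positive definiteness excludes a second representative, which resolves
  the description in \<open>sharp\<close>. The explicit sum is also what yields smoothness.\<close>

lemma sharp_frame:
  assumes frame: "orthonormal_frame U e" and p: "p \<in> U"
  shows "sharp A \<alpha> \<beta> p = (\<Sum>i\<in>Basis. \<beta> p (e i p) *\<^sub>R e i p)"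
    and "v \<in> tangent_space A p \<Longrightarrow> \<alpha> p (sharp A \<alpha> \<beta> p) v = \<beta> p v"
proof -
  note top = frame_topspace[OF frame p]
  note T = frame_tangent[OF frame p]
  let ?b = "\<Sum>i\<in>Basis. \<beta> p (e i p) *\<^sub>R e i p"
  have bT: "?b \<in> tangent_space A p" by (intro tangent_sum tangent_scale T)
  have b: "\<alpha> p ?b v = \<beta> p v" if v: "v \<in> tangent_space A p" for v
  proof -
    have "\<alpha> p ?b v = (\<Sum>i\<in>Basis. \<beta> p (e i p) * \<alpha> p (e i p) v)"
      by (simp add: metric_sum_left[OF top] metric_scale_left[OF top] T v tangent_scale)
    also have "\<dots> = (\<Sum>i\<in>Basis. \<alpha> p v (e i p) * \<beta> p (e i p))"
      by (rule sum.cong) (simp_all add: metric_sym[OF top v] T)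
    also have "\<dots> = \<beta> p (\<Sum>i\<in>Basis. \<alpha> p v (e i p) *\<^sub>R e i p)"
      by (simp add: form_sum[OF top] form_scale[OF top] T tangent_scale)
    also have "(\<Sum>i\<in>Basis. \<alpha> p v (e i p) *\<^sub>R e i p) = v"
      by (rule frame_expansion[OF frame p v, symmetric])
    finally show ?thesis .
  qed
  show eq: "sharp A \<alpha> \<beta> p = ?b"
    unfolding sharp_def
  proof (rule the_equality)
    show "?b \<in> tangent_space A p \<and> (\<forall>y\<in>tangent_space A p. \<alpha> p ?b y = \<beta> p y)" using b bT by blast
    fix b' assume b': "b' \<in> tangent_space A p \<and> (\<forall>y\<in>tangent_space A p. \<alpha> p b' y = \<beta> p y)"
    have "\<alpha> p (b' - ?b) (b' - ?b) = 0"
      using b' b bT tangent_diff[of b' p ?b] by (simp add: metric_diff_left[OF top])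
    then show "b' = ?b"
      using metric_eq_zeroD[OF top tangent_diff, of b' ?b] b' bT by simp
  qed
  show "v \<in> tangent_space A p \<Longrightarrow> \<alpha> p (sharp A \<alpha> \<beta> p) v = \<beta> p v"
    unfolding eq by (rule b)
qed

lemma sharp_smooth: "smooth_vfield M A (topspace M) (sharp A \<alpha> \<beta>)"
proof (rule smooth_vfield_local)
  fix p assume "p \<in> topspace M"
  then obtain c e where c: "c \<in> A" "p \<in> fst c" and e: "orthonormal_frame (fst c) e"
    using chart_exists orthonormal_frame_exists by metis
  have "smooth_vfield M A (fst c) (\<lambda>p. \<Sum>i\<in>Basis. \<beta> p (e i p) *\<^sub>R e i p)"
    by (intro smooth_vfield_sum smooth_vfield_scale form_smooth frame_smooth[OF e] c openin_chart)
  then have "smooth_vfield M A (fst c) (sharp A \<alpha> \<beta>)"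
    by (rule smooth_vfield_cong) (simp add: sharp_frame(1)[OF e])
  then show "\<exists>V. p \<in> V \<and> smooth_vfield M A V (sharp A \<alpha> \<beta>)" using c by blast
qed simp

lemma sharp_tangent: "p \<in> topspace M \<Longrightarrow> sharp A \<alpha> \<beta> p \<in> tangent_space A p"
  by (rule smooth_vfield_tangent[OF sharp_smooth])

lemma metric_sharp: "p \<in> topspace M \<Longrightarrow> v \<in> tangent_space A p \<Longrightarrow> \<alpha> p (sharp A \<alpha> \<beta> p) v = \<beta> p v"
  using chart_exists orthonormal_frame_exists sharp_frame(2) by metis

end

section \<open>The optimization problem\<close>

context riemannian_manifold
begin

context
  fixes p B assumes p: "p \<in> topspace M" and B: "orthonormal_basis A \<alpha> p B"
begin

lemma orthonormal_basis_tangent: "f \<in> B \<Longrightarrow> f \<in> tangent_space A p"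
  using B span_base unfolding orthonormal_basis_def by blast

lemma orthonormal_basis_expansion:
  assumes v: "v \<in> tangent_space A p"
  shows "v = (\<Sum>f\<in>B. \<alpha> p v f *\<^sub>R f)"
proof -
  have fin: "finite B" and on: "\<And>f g. f \<in> B \<Longrightarrow> g \<in> B \<Longrightarrow> \<alpha> p f g = (if f = g then 1 else 0)"
    and "span B = tangent_space A p"
    using B unfolding orthonormal_basis_def by blast+
  then have "v \<in> range (\<lambda>u. \<Sum>f\<in>B. u f *\<^sub>R f)"
    using v span_finite[OF fin] by simp
  then obtain u where u: "v = (\<Sum>f\<in>B. u f *\<^sub>R f)" by blast
  have "\<alpha> p v g = u g" if g: "g \<in> B" for g
  proof -
    have "\<alpha> p v g = (\<Sum>f\<in>B. u f * \<alpha> p f g)"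
      unfolding u using g
      by (simp add: metric_sum_left[OF p] metric_scale_left[OF p] orthonormal_basis_tangent tangent_scale)
    also have "\<dots> = (\<Sum>f\<in>B. if f = g then u f else 0)"
      by (rule sum.cong) (use on g in auto)
    finally show ?thesis using fin g by simp
  qed
  then have "(\<Sum>f\<in>B. \<alpha> p v f *\<^sub>R f) = (\<Sum>f\<in>B. u f *\<^sub>R f)"
    by (intro sum.cong) simp_all
  then show ?thesis using u by simp
qed

lemma parseval:
  assumes v: "v \<in> tangent_space A p" and w: "w \<in> tangent_space A p"
  shows "(\<Sum>f\<in>B. \<alpha> p v f * \<alpha> p w f) = \<alpha> p v w"
proof -
  have "\<alpha> p v w = \<alpha> p v (\<Sum>f\<in>B. \<alpha> p w f *\<^sub>R f)"
    using orthonormal_basis_expansion[OF w] by simp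
  also have "\<dots> = (\<Sum>f\<in>B. \<alpha> p w f * \<alpha> p v f)"
    by (simp add: metric_sum_right[OF p] metric_scale_right[OF p] v orthonormal_basis_tangent tangent_scale)
  finally show ?thesis by (simp add: mult.commute)
qed

end

text \<open>At a fixed point \<open>p\<close>, \<open>b\<close> is the value of the vector field and \<open>W x\<close> is \<open>\<nabla>\<^sup>*\<^sub>x b\<close>.\<close>

context
  fixes p b K W
  assumes p: "p \<in> topspace M" and K: "0 < K" and b: "b p \<in> tangent_space A p"
    and norm_b: "\<alpha> p (b p) (b p) = K\<^sup>2"
    and W: "\<And>x. x \<in> tangent_space A p \<Longrightarrow> W p x b \<in> tangent_space A p"
    and W_linear: "linear_on (tangent_space A p) (\<lambda>x. W p x b)"
    and W_orth: "\<And>x. x \<in> tangent_space A p \<Longrightarrow> \<alpha> p (W p x b) (b p) = 0"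
begin

abbreviation (input) "T0 \<equiv> difference_tensor \<alpha> b W K p"

lemma difference_tensor_tangent:
  "x \<in> tangent_space A p \<Longrightarrow> T0 x y \<in> tangent_space A p"
  unfolding difference_tensor_def by (intro tangent_diff tangent_scale b W)

lemma metric_difference_tensor:
  assumes "x \<in> tangent_space A p" "z \<in> tangent_space A p"
  shows "\<alpha> p (T0 x y) z = \<alpha> p (W p x b) y / K\<^sup>2 * \<alpha> p (b p) z - \<alpha> p y (b p) / K\<^sup>2 * \<alpha> p (W p x b) z"
  unfolding difference_tensor_def
  by (simp add: metric_diff_left[OF p] metric_scale_left[OF p] b W assms tangent_scale)

text \<open>Up to the factor \<open>1 / K\<^sup>2\<close> this is the wedge product of
  \<open>b\<close> and \<open>W x\<close>: exchanging the two arguments exchanges the two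
  terms.\<close>

lemma difference_tensor_skew:
  assumes "x \<in> tangent_space A p" "y \<in> tangent_space A p" "z \<in> tangent_space A p"
  shows "\<alpha> p (T0 x y) z = - \<alpha> p (T0 x z) y"
  using metric_sym[OF p b assms(2)] metric_sym[OF p b assms(3)]
  by (simp add: metric_difference_tensor assms mult.commute)

text \<open>Orthogonality of \<open>W x\<close> and \<open>b\<close> kills the first term, and the
  denominator \<open>K\<^sup>2\<close> is there to turn the coefficient of the second into
  1.\<close>

lemma difference_tensor_sharp:
  assumes "x \<in> tangent_space A p"
  shows "T0 x (b p) = - W p x b"
  using K unfolding difference_tensor_def by (simp add: W_orth[OF assms] norm_b)

lemma linear_on_difference_tensor_right:
  assumes x: "x \<in> tangent_space A p"
  shows "linear_on (tangent_space A p) (T0 x)"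
  unfolding linear_on_def difference_tensor_def
  by (auto simp: metric_add_left[OF p] metric_add_right[OF p] metric_scale_left[OF p]
      metric_scale_right[OF p] W[OF x] b add_divide_distrib scaleR_add_left algebra_simps)

lemma linear_on_difference_tensor_left:
  assumes y: "y \<in> tangent_space A p"
  shows "linear_on (tangent_space A p) (\<lambda>x. T0 x y)"
proof -
  have add: "W p (u + v) b = W p u b + W p v b"
    if "u \<in> tangent_space A p" "v \<in> tangent_space A p" for u v
    using W_linear that unfolding linear_on_def by blast
  have scale: "W p (r *\<^sub>R v) b = r *\<^sub>R W p v b" if "v \<in> tangent_space A p" for r v
    using W_linear that unfolding linear_on_def by blast
  show ?thesis
    unfolding linear_on_def difference_tensor_def
    by (auto simp: add scale metric_add_left[OF p] metric_scale_left[OF p]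
        W y add_divide_distrib scaleR_add_left algebra_simps)
qed

lemma difference_tensor_feasible: "feasible A \<alpha> b W p T0"
  unfolding feasible_def bilinear_on_def
  using difference_tensor_tangent difference_tensor_skew difference_tensor_sharp
    linear_on_difference_tensor_right linear_on_difference_tensor_left by blast

text \<open>The difference \<open>N\<close> of a feasible endomorphism and \<open>T0 x\<close> is skew and kills \<open>b\<close>, while \<open>T0 x\<close> takes
  values in the span of \<open>b\<close> and \<open>W x\<close>; so the two are orthogonal.\<close>

lemma endo_norm_sq_feasible:
  assumes T: "feasible A \<alpha> b W p T" and x: "x \<in> tangent_space A p"
  shows "endo_norm_sq A \<alpha> p (T x) = endo_norm_sq A \<alpha> p (T0 x) + endo_norm_sq A \<alpha> p (\<lambda>y. T x y - T0 x y)"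
    and "endo_norm_sq A \<alpha> p (\<lambda>y. T x y - T0 x y) \<le> 0 \<Longrightarrow> y \<in> tangent_space A p \<Longrightarrow> T x y = T0 x y"
proof -
  define N where "N y = T x y - T0 x y" for y
  have N_eq: "(\<lambda>y. T x y - T0 x y) = N" by (simp only: N_def[abs_def])
  define B where "B = (SOME B. orthonormal_basis A \<alpha> p B)"
  have B: "orthonormal_basis A \<alpha> p B"
    unfolding B_def using someI_ex[OF orthonormal_basis_exists[OF p]] .
  have fin: "finite B" using B by (simp add: orthonormal_basis_def)
  note BT = orthonormal_basis_tangent[OF p B]
  have norm: "endo_norm_sq A \<alpha> p L = (\<Sum>e\<in>B. \<Sum>f\<in>B. (\<alpha> p (L f) e)\<^sup>2)" for L
    by (simp add: endo_norm_sq_def B_def Let_def)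
  have TT: "T x y \<in> tangent_space A p" if "y \<in> tangent_space A p" for y
    using T x that unfolding feasible_def by blast
  have T_skew: "\<alpha> p (T x y) z = - \<alpha> p (T x z) y"
    if "y \<in> tangent_space A p" "z \<in> tangent_space A p" for y z
    using T x that unfolding feasible_def by blast
  have "T x (b p) = - W p x b" using T x unfolding feasible_def by blast
  then have N_b: "N (b p) = 0" using difference_tensor_sharp[OF x] by (simp only: N_def) simp
  have NT: "N y \<in> tangent_space A p" if "y \<in> tangent_space A p" for y
    unfolding N_def by (intro tangent_diff TT difference_tensor_tangent x that)
  have N_skew: "\<alpha> p (N y) z = - \<alpha> p (N z) y"
    if y: "y \<in> tangent_space A p" and z: "z \<in> tangent_space A p" for y z
    using T_skew[OF y z] difference_tensor_skew[OF x y z]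
    unfolding N_def by (simp add: metric_diff_left[OF p] TT difference_tensor_tangent x y z)
  \<comment> \<open>A skew map that kills \<open>b\<close> takes values orthogonal to
    \<open>b\<close>.\<close>
  have N_orth_b: "\<alpha> p (N y) (b p) = 0" if y: "y \<in> tangent_space A p" for y
    using N_skew[OF y b] by (simp add: N_b metric_zero_left[OF p] y)
  note Wx = W[OF x]
  have cross_f: "\<alpha> p (T0 x f) (N f) = \<alpha> p (N (W p x b)) f * \<alpha> p (b p) f / K\<^sup>2" if f: "f \<in> B" for f
  proof -
    have "\<alpha> p (T0 x f) (N f) = - (\<alpha> p f (b p) / K\<^sup>2 * \<alpha> p (W p x b) (N f))"
      using metric_difference_tensor[OF x NT[OF BT[OF f]]] N_orth_b[OF BT[OF f]]
        metric_sym[OF p b NT[OF BT[OF f]]] by simp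
    also have "\<alpha> p (W p x b) (N f) = - \<alpha> p (N (W p x b)) f"
      using metric_sym[OF p Wx NT[OF BT[OF f]]] N_skew[OF BT[OF f] Wx] by simp
    finally show ?thesis using metric_sym[OF p BT[OF f] b] by simp
  qed
  have "(\<Sum>f\<in>B. \<alpha> p (T0 x f) (N f)) = (\<Sum>f\<in>B. \<alpha> p (N (W p x b)) f * \<alpha> p (b p) f) / K\<^sup>2"
    by (simp add: cross_f sum_divide_distrib)
  \<comment> \<open>Parseval collapses the sum to the product of \<open>N (W p x b)\<close> and
    \<open>b p\<close>, and values of \<open>N\<close> are orthogonal to \<open>b p\<close>.\<close>
  also have "\<dots> = 0"
    using parseval[OF p B NT[OF Wx] b] N_orth_b[OF Wx] by simp
  finally have cross: "(\<Sum>f\<in>B. \<alpha> p (T0 x f) (N f)) = 0" .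
  have "endo_norm_sq A \<alpha> p (T x)
      = (\<Sum>e\<in>B. \<Sum>f\<in>B. (\<alpha> p (T0 x f) e)\<^sup>2 + (\<alpha> p (N f) e)\<^sup>2 + 2 * (\<alpha> p (T0 x f) e * \<alpha> p (N f) e))"
    unfolding norm
  proof (intro sum.cong refl)
    fix e f assume e: "e \<in> B" and f: "f \<in> B"
    have "\<alpha> p (T x f) e = \<alpha> p (T0 x f) e + \<alpha> p (N f) e"
      unfolding N_def by (simp add: metric_diff_left[OF p] TT difference_tensor_tangent x BT e f)
    then show "(\<alpha> p (T x f) e)\<^sup>2 = (\<alpha> p (T0 x f) e)\<^sup>2 + (\<alpha> p (N f) e)\<^sup>2 + 2 * (\<alpha> p (T0 x f) e * \<alpha> p (N f) e)"
      by (simp add: power2_sum)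
  qed
  also have "\<dots> = endo_norm_sq A \<alpha> p (T0 x) + endo_norm_sq A \<alpha> p N
      + 2 * (\<Sum>e\<in>B. \<Sum>f\<in>B. \<alpha> p (T0 x f) e * \<alpha> p (N f) e)"
    by (simp add: norm sum.distrib sum_distrib_left)
  also have "(\<Sum>e\<in>B. \<Sum>f\<in>B. \<alpha> p (T0 x f) e * \<alpha> p (N f) e) = (\<Sum>f\<in>B. \<alpha> p (T0 x f) (N f))"
    by (subst sum.swap, intro sum.cong refl parseval[OF p B] difference_tensor_tangent x NT BT)
  finally show "endo_norm_sq A \<alpha> p (T x) = endo_norm_sq A \<alpha> p (T0 x) + endo_norm_sq A \<alpha> p (\<lambda>y. T x y - T0 x y)"
    unfolding N_eq by (simp add: cross)
  show "T x y = T0 x y" if le': "endo_norm_sq A \<alpha> p (\<lambda>y. T x y - T0 x y) \<le> 0" and y: "y \<in> tangent_space A p"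
  proof -
    have le: "endo_norm_sq A \<alpha> p N \<le> 0" using le' unfolding N_eq .
    have inner: "0 \<le> (\<Sum>f\<in>B. (\<alpha> p (N f) e)\<^sup>2)" for e by (rule sum_nonneg) simp
    have "endo_norm_sq A \<alpha> p N = 0"
      using le sum_nonneg[of B "\<lambda>e. \<Sum>f\<in>B. (\<alpha> p (N f) e)\<^sup>2"] inner unfolding norm by simp
    then have zero: "\<alpha> p (N f) e = 0" if "e \<in> B" "f \<in> B" for e f
      using that fin inner unfolding norm by (simp add: sum_nonneg_eq_0_iff)
    have N_basis: "N f = 0" if f: "f \<in> B" for f
    proof -
      have "N f = (\<Sum>e\<in>B. \<alpha> p (N f) e *\<^sub>R e)"
        by (rule orthonormal_basis_expansion[OF p B NT[OF BT[OF f]]])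
      also have "\<dots> = (\<Sum>e\<in>B. 0)" by (rule sum.cong) (simp_all only: zero f scaleR_zero_left)
      finally show ?thesis by simp
    qed
    \<comment> \<open>Skewness carries the vanishing from the basis to an arbitrary
      \<open>y\<close>, because the product of \<open>N y\<close> with \<open>e\<close> is minus
      that of \<open>N e\<close> with \<open>y\<close>.\<close>
    have "\<alpha> p (N y) e = 0" if e: "e \<in> B" for e
      using N_skew[OF y BT[OF e]] N_basis[OF e] metric_zero_left[OF p y] by simp
    then have "(\<Sum>e\<in>B. \<alpha> p (N y) e *\<^sub>R e) = (\<Sum>e\<in>B. 0)"
      by (intro sum.cong) simp_all
    then have "N y = 0" using orthonormal_basis_expansion[OF p B NT[OF y]] by simp
    then show ?thesis by (simp add: N_def)
  qed
qed

text \<open>The norm evaluates an endomorphism only at basis vectors, which are tangent; its values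
  elsewhere are arbitrary.\<close>

lemma endo_norm_sq_cong:
  assumes "\<And>y. y \<in> tangent_space A p \<Longrightarrow> L y = L' y"
  shows "endo_norm_sq A \<alpha> p L = endo_norm_sq A \<alpha> p L'"
proof -
  have "orthonormal_basis A \<alpha> p (SOME B. orthonormal_basis A \<alpha> p B)"
    using someI_ex[OF orthonormal_basis_exists[OF p]] .
  note BT = orthonormal_basis_tangent[OF p this]
  show ?thesis
    unfolding endo_norm_sq_def Let_def by (intro sum.cong refl) (simp add: assms BT)
qed

lemma endo_norm_sq_nonneg: "0 \<le> endo_norm_sq A \<alpha> p L"
  unfolding endo_norm_sq_def Let_def by (intro sum_nonneg) simp

text \<open>Minimality against the feasible tensor \<open>T0\<close> leaves no room for the extra
  summand in \<open>endo_norm_sq_feasible\<close>, so the difference has norm zero. Since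
  \<open>T\<close> is a total function, equality can hold on tangent vectors only, and in the
  converse direction feasibility has to be carried over from \<open>T0\<close>.\<close>

lemma pointwise_solution_iff:
  "pointwise_solution A \<alpha> b W p T \<longleftrightarrow>
    (\<forall>x\<in>tangent_space A p. \<forall>y\<in>tangent_space A p. T x y = T0 x y)"
proof
  assume T: "pointwise_solution A \<alpha> b W p T"
  then have feas: "feasible A \<alpha> b W p T" by (simp add: pointwise_solution_def)
  show "\<forall>x\<in>tangent_space A p. \<forall>y\<in>tangent_space A p. T x y = T0 x y"
  proof (intro ballI)
    fix x y assume x: "x \<in> tangent_space A p" and y: "y \<in> tangent_space A p"
    have "endo_norm_sq A \<alpha> p (T x) \<le> endo_norm_sq A \<alpha> p (T0 x)"
      using T difference_tensor_feasible x unfolding pointwise_solution_def by blast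
    then have "endo_norm_sq A \<alpha> p (\<lambda>y. T x y - T0 x y) \<le> 0"
      using endo_norm_sq_feasible(1)[OF feas x] by linarith
    then show "T x y = T0 x y" by (rule endo_norm_sq_feasible(2)[OF feas x _ y])
  qed
next
  assume eq: "\<forall>x\<in>tangent_space A p. \<forall>y\<in>tangent_space A p. T x y = T0 x y"
  have feas: "feasible A \<alpha> b W p T"
    unfolding feasible_def bilinear_on_def
  proof (intro conjI ballI)
    fix x assume x: "x \<in> tangent_space A p"
    show "linear_on (tangent_space A p) (T x)"
      using linear_on_difference_tensor_right[OF x] eq x
      unfolding linear_on_def by (simp add: tangent_add tangent_scale)
    show "linear_on (tangent_space A p) (\<lambda>y. T y x)"
      using linear_on_difference_tensor_left[OF x] eq x
      unfolding linear_on_def by (simp add: tangent_add tangent_scale)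
    show "T x (b p) = - W p x b" using difference_tensor_sharp[OF x] eq x b by simp
    fix y assume y: "y \<in> tangent_space A p"
    show "T x y \<in> tangent_space A p" using difference_tensor_tangent[OF x] eq x y by simp
    fix z assume z: "z \<in> tangent_space A p"
    show "\<alpha> p (T x y) z = - \<alpha> p (T x z) y" using difference_tensor_skew[OF x y z] eq x y z by simp
  qed
  show "pointwise_solution A \<alpha> b W p T"
    unfolding pointwise_solution_def
  proof (intro conjI allI impI ballI)
    fix T' x assume T': "feasible A \<alpha> b W p T'" and x: "x \<in> tangent_space A p"
    have "endo_norm_sq A \<alpha> p (T x) = endo_norm_sq A \<alpha> p (T0 x)"
      by (rule endo_norm_sq_cong) (use eq x in blast)
    also have "\<dots> \<le> endo_norm_sq A \<alpha> p (T' x)"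
      using endo_norm_sq_feasible(1)[OF T' x] endo_norm_sq_nonneg[of "\<lambda>y. T' x y - T0 x y"] by linarith
    finally show "endo_norm_sq A \<alpha> p (T x) \<le> endo_norm_sq A \<alpha> p (T' x)" .
  qed (rule feas)
qed

end

end

section \<open>Connections and compatibility\<close>

context manifold
begin

context
  fixes D assumes D: "linear_connection M A D"
begin

lemmas connection_clauses = D[unfolded linear_connection_def]

lemma connection_tangent:
  assumes "smooth_vfield M A U X" "p \<in> U" "v \<in> tangent_space A p"
  shows "D p v X \<in> tangent_space A p"
  by (rule connection_clauses[THEN conjunct1, rule_format, OF conjI[OF assms(1,2)], THEN conjunct1,
        rule_format, OF assms(3)])

lemma connection_linear_on:
  assumes "smooth_vfield M A U X" "p \<in> U"
  shows "linear_on (tangent_space A p) (\<lambda>v. D p v X)"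
  by (rule connection_clauses[THEN conjunct1, rule_format, OF conjI[OF assms(1,2)], THEN conjunct2])

lemma connection_add:
  assumes "smooth_vfield M A U X" "smooth_vfield M A U Y" "p \<in> U" "v \<in> tangent_space A p"
  shows "D p v (\<lambda>q. X q + Y q) = D p v X + D p v Y"
  by (rule connection_clauses[THEN conjunct2, THEN conjunct1, rule_format,
        OF conjI[OF assms(1) conjI[OF assms(2,3)]] assms(4)])

lemma connection_local:
  assumes "smooth_vfield M A U X" "smooth_vfield M A U Y" "p \<in> U" "\<forall>q\<in>U. X q = Y q"
    "v \<in> tangent_space A p"
  shows "D p v X = D p v Y"
  by (rule connection_clauses[THEN conjunct2, THEN conjunct2, THEN conjunct1, THEN spec, THEN spec,
        THEN spec, THEN spec, THEN mp, OF conjI[OF assms(1) conjI[OF assms(2) conjI[OF assms(3,4)]]],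
        THEN bspec, OF assms(5)])

lemma connection_leibniz:
  assumes "smooth_fun M A U f" "smooth_vfield M A U X" "p \<in> U" "v \<in> tangent_space A p"
  shows "D p v (\<lambda>q. f q *\<^sub>R X q) = dir_deriv A p v f *\<^sub>R X p + f p *\<^sub>R D p v X"
  by (rule connection_clauses[THEN conjunct2, THEN conjunct2, THEN conjunct2, THEN conjunct1,
        rule_format, OF conjI[OF assms(1) conjI[OF assms(2,3)]] assms(4)])

lemma connection_smooth:
  assumes "smooth_vfield M A U X" "smooth_vfield M A U Y"
  shows "smooth_vfield M A U (\<lambda>p. D p (X p) Y)"
  by (rule connection_clauses[THEN conjunct2, THEN conjunct2, THEN conjunct2, THEN conjunct2,
        rule_format, OF conjI[OF assms(1,2)]])

end

text \<open>The representation consists of the single field \<open>X\<close> with coefficient 1,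
  whose derivative is 0.\<close>

lemma has_covariant_derivative_vfield:
  assumes "smooth_vfield M A U X" "\<gamma> t \<in> U"
  shows "has_covariant_derivative M A D \<gamma> (\<lambda>s. X (\<gamma> s)) t (D (\<gamma> t) (velocity A \<gamma> t) X)"
  unfolding has_covariant_derivative_def
  by (rule exI[of _ U], rule exI[of _ 1], rule exI[of _ "\<lambda>_. X"], rule exI[of _ "\<lambda>_ _. 1"],
      rule exI[of _ "\<lambda>_. 0"]) (use assms in simp)

end

context riemannian_manifold
begin

lemma metric_sum_sum:
  assumes "p \<in> topspace M" "\<And>i. i \<in> I \<Longrightarrow> v i \<in> tangent_space A p"
    "\<And>j. j \<in> J \<Longrightarrow> w j \<in> tangent_space A p"
  shows "\<alpha> p (\<Sum>i\<in>I. v i) (\<Sum>j\<in>J. w j) = (\<Sum>i\<in>I. \<Sum>j\<in>J. \<alpha> p (v i) (w j))"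
proof -
  have "\<alpha> p (\<Sum>i\<in>I. v i) (\<Sum>j\<in>J. w j) = (\<Sum>i\<in>I. \<alpha> p (v i) (\<Sum>j\<in>J. w j))"
    by (intro metric_sum_left tangent_sum assms)
  also have "\<dots> = (\<Sum>i\<in>I. \<Sum>j\<in>J. \<alpha> p (v i) (w j))"
    by (intro sum.cong refl metric_sum_right assms)
  finally show ?thesis .
qed

lemma metric_connectionD:
  assumes "metric_connection M A \<alpha> D" "smooth_vfield M A U X" "smooth_vfield M A U Y" "p \<in> U"
    "v \<in> tangent_space A p"
  shows "dir_deriv A p v (\<lambda>q. \<alpha> q (X q) (Y q)) = \<alpha> p (D p v X) (Y p) + \<alpha> p (X p) (D p v Y)"
  by (rule assms(1)[unfolded metric_connection_def, rule_format,
        OF conjI[OF assms(2) conjI[OF assms(3,4)]] assms(5)])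

text \<open>\<open>metric_connection\<close> speaks of fields on open sets, whereas parallel fields
  live on a curve. Representing both \<open>V\<close> and \<open>W\<close> bridges the gap: the
  metric property covers the products of \<open>E i\<close> and \<open>H j\<close>, the ordinary
  product rule covers the coefficients, and bilinearity reassembles the two.\<close>

lemma metric_covariant_derivative:
  assumes D: "linear_connection M A D" "metric_connection M A \<alpha> D"
    and \<gamma>: "smooth_curve M A I \<gamma>" "t \<in> I"
    and V: "has_covariant_derivative M A D \<gamma> V t v" and W: "has_covariant_derivative M A D \<gamma> W t w"
  shows "((\<lambda>s. \<alpha> (\<gamma> s) (V s) (W s)) has_real_derivative \<alpha> (\<gamma> t) v (W t) + \<alpha> (\<gamma> t) (V t) w) (at t)"
proof -
  define P where "P U k E a a' V v \<longleftrightarrow> \<gamma> t \<in> U \<and>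
      (\<forall>i<k. smooth_vfield M A U (E i) \<and> (a i has_real_derivative a' i) (at t)) \<and>
      (\<forall>\<^sub>F s in nhds t. V s = (\<Sum>i<k. a i s *\<^sub>R E i (\<gamma> s))) \<and>
      v = (\<Sum>i<k. a' i *\<^sub>R E i (\<gamma> t) + a i t *\<^sub>R D (\<gamma> t) (velocity A \<gamma> t) (E i))"
    for U and k :: nat and E a a' V v
  obtain U m E a a' where V0: "P U m E a a' V v"
    using V unfolding has_covariant_derivative_def P_def[symmetric] by (elim exE)
  obtain U' n H b b' where W0: "P U' n H b b' W w"
    using W unfolding has_covariant_derivative_def P_def[symmetric] by (elim exE)
  from V0[unfolded P_def] have U: "\<gamma> t \<in> U"
    and E: "\<And>i. i < m \<Longrightarrow> smooth_vfield M A U (E i)"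
    and a: "\<And>i. i < m \<Longrightarrow> (a i has_real_derivative a' i) (at t)"
    and V_eq: "\<forall>\<^sub>F s in nhds t. V s = (\<Sum>i<m. a i s *\<^sub>R E i (\<gamma> s))"
    and v: "v = (\<Sum>i<m. a' i *\<^sub>R E i (\<gamma> t) + a i t *\<^sub>R D (\<gamma> t) (velocity A \<gamma> t) (E i))"
    by (elim conjE, simp)+
  from W0[unfolded P_def] have U': "\<gamma> t \<in> U'"
    and H: "\<And>j. j < n \<Longrightarrow> smooth_vfield M A U' (H j)"
    and b: "\<And>j. j < n \<Longrightarrow> (b j has_real_derivative b' j) (at t)"
    and W_eq: "\<forall>\<^sub>F s in nhds t. W s = (\<Sum>j<n. b j s *\<^sub>R H j (\<gamma> s))"
    and w: "w = (\<Sum>j<n. b' j *\<^sub>R H j (\<gamma> t) + b j t *\<^sub>R D (\<gamma> t) (velocity A \<gamma> t) (H j))"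
    by (elim conjE, simp)+
  let ?q = "\<gamma> t" and ?u = "velocity A \<gamma> t"
  note q = curve_in_topspace[OF \<gamma>] and u = velocity_in_tangent_space[OF \<gamma>]
  have ET: "E i p \<in> tangent_space A p" if "i < m" "p \<in> U" for i p
    by (rule smooth_vfield_tangent[OF E]) (use that in auto)
  have HT: "H j p \<in> tangent_space A p" if "j < n" "p \<in> U'" for j p
    by (rule smooth_vfield_tangent[OF H]) (use that in auto)
  have DE: "D ?q ?u (E i) \<in> tangent_space A ?q" if "i < m" for i
    by (rule connection_tangent[OF D(1) E U u]) (rule that)
  have DH: "D ?q ?u (H j) \<in> tangent_space A ?q" if "j < n" for j
    by (rule connection_tangent[OF D(1) H U' u]) (rule that)
  \<comment> \<open>Openness of \<open>U\<close> is known only through the smoothness of some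
    \<open>E i\<close>. For \<open>m = 0\<close> nothing is known about \<open>U\<close>, so the
    statement stays conditional on an index.\<close>
  have near: "\<forall>\<^sub>F s in nhds t. s \<in> I \<and> \<gamma> s \<in> U" if "i < m" for i
    using eventually_nhds_in_open[OF open_curve_preimage[OF \<gamma>(1) smooth_vfield_openin[OF E[OF that]]], of t]
      \<gamma> U by simp
  have near': "\<forall>\<^sub>F s in nhds t. s \<in> I \<and> \<gamma> s \<in> U'" if "j < n" for j
    using eventually_nhds_in_open[OF open_curve_preimage[OF \<gamma>(1) smooth_vfield_openin[OF H[OF that]]], of t]
      \<gamma> U' by simp
  have "\<forall>\<^sub>F s in nhds t. s \<in> I"
    using eventually_nhds_in_open[of I t] \<gamma> by (simp add: smooth_curve_def)
  moreover have "\<forall>\<^sub>F s in nhds t. \<forall>i\<in>{..<m}. s \<in> I \<and> \<gamma> s \<in> U"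
    using near by (intro eventually_ball_finite finite_lessThan) simp
  moreover have "\<forall>\<^sub>F s in nhds t. \<forall>j\<in>{..<n}. s \<in> I \<and> \<gamma> s \<in> U'"
    using near' by (intro eventually_ball_finite finite_lessThan) simp
  ultimately have eq: "\<forall>\<^sub>F s in nhds t. \<alpha> (\<gamma> s) (V s) (W s)
      = (\<Sum>i<m. \<Sum>j<n. a i s * b j s * \<alpha> (\<gamma> s) (E i (\<gamma> s)) (H j (\<gamma> s)))"
    using V_eq W_eq
  proof eventually_elim
    case (elim s)
    have top: "\<gamma> s \<in> topspace M" using curve_in_topspace[OF \<gamma>(1) elim(1)] .
    have E': "E i (\<gamma> s) \<in> tangent_space A (\<gamma> s)" if "i < m" for i using ET[OF that] bspec[OF elim(2), of i] that by simp
    have H': "H j (\<gamma> s) \<in> tangent_space A (\<gamma> s)" if "j < n" for j using HT[OF that] bspec[OF elim(3), of j] that by simp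
    have "\<alpha> (\<gamma> s) (V s) (W s)
      = (\<Sum>i<m. \<Sum>j<n. \<alpha> (\<gamma> s) (a i s *\<^sub>R E i (\<gamma> s)) (b j s *\<^sub>R H j (\<gamma> s)))"
      unfolding elim(4,5) by (rule metric_sum_sum[OF top]) (auto intro: tangent_scale E' H')
    also have "\<dots> = (\<Sum>i<m. \<Sum>j<n. a i s * b j s * \<alpha> (\<gamma> s) (E i (\<gamma> s)) (H j (\<gamma> s)))"
      by (intro sum.cong refl)
        (simp add: metric_scale_left[OF top] metric_scale_right[OF top] E' H' tangent_scale)
    finally show ?case .
  qed
  have deriv: "((\<lambda>s. \<alpha> (\<gamma> s) (E i (\<gamma> s)) (H j (\<gamma> s))) has_real_derivative
      \<alpha> ?q (D ?q ?u (E i)) (H j ?q) + \<alpha> ?q (E i ?q) (D ?q ?u (H j))) (at t)"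
    if i: "i < m" and j: "j < n" for i j
  proof -
    have op: "openin M (U \<inter> U')"
      using smooth_vfield_openin[OF E[OF i]] smooth_vfield_openin[OF H[OF j]] by (rule openin_Int)
    have E': "smooth_vfield M A (U \<inter> U') (E i)" and H': "smooth_vfield M A (U \<inter> U') (H j)"
      by (rule smooth_vfield_subset[OF E[OF i] op], simp)
        (rule smooth_vfield_subset[OF H[OF j] op], simp)
    have "dir_deriv A ?q ?u (\<lambda>p. \<alpha> p (E i p) (H j p))
        = \<alpha> ?q (D ?q ?u (E i)) (H j ?q) + \<alpha> ?q (E i ?q) (D ?q ?u (H j))"
      using U U' by (intro metric_connectionD[OF D(2) E' H' _ u]) simp
    then show ?thesis
      using has_real_derivative_along_curve[OF \<gamma> metric_smooth[OF E' H']] U U' by simp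
  qed
  have "((\<lambda>s. \<Sum>i<m. \<Sum>j<n. a i s * b j s * \<alpha> (\<gamma> s) (E i (\<gamma> s)) (H j (\<gamma> s))) has_real_derivative
    (\<Sum>i<m. \<Sum>j<n. (a' i * b j t + b' j * a i t) * \<alpha> ?q (E i ?q) (H j ?q)
      + (\<alpha> ?q (D ?q ?u (E i)) (H j ?q) + \<alpha> ?q (E i ?q) (D ?q ?u (H j))) * (a i t * b j t))) (at t)"
    by (intro DERIV_sum DERIV_mult a b deriv) auto
  moreover have "(\<Sum>i<m. \<Sum>j<n. (a' i * b j t + b' j * a i t) * \<alpha> ?q (E i ?q) (H j ?q)
      + (\<alpha> ?q (D ?q ?u (E i)) (H j ?q) + \<alpha> ?q (E i ?q) (D ?q ?u (H j))) * (a i t * b j t))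
    = \<alpha> ?q v (W t) + \<alpha> ?q (V t) w"
  proof -
    have Vt: "V t = (\<Sum>i<m. a i t *\<^sub>R E i ?q)" and Wt: "W t = (\<Sum>j<n. b j t *\<^sub>R H j ?q)"
      using eventually_nhds_x_imp_x[OF V_eq] eventually_nhds_x_imp_x[OF W_eq] by simp_all
    have T: "\<And>i. i < m \<Longrightarrow> E i ?q \<in> tangent_space A ?q" "\<And>j. j < n \<Longrightarrow> H j ?q \<in> tangent_space A ?q"
      using ET HT U U' by auto
    have "\<alpha> ?q v (W t) = (\<Sum>i<m. \<Sum>j<n.
        \<alpha> ?q (a' i *\<^sub>R E i ?q + a i t *\<^sub>R D ?q ?u (E i)) (b j t *\<^sub>R H j ?q))"
      unfolding v Wt by (rule metric_sum_sum[OF q]) (auto intro: tangent_scale tangent_add T DE)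
    also have "\<dots> = (\<Sum>i<m. \<Sum>j<n. a' i * b j t * \<alpha> ?q (E i ?q) (H j ?q)
        + a i t * b j t * \<alpha> ?q (D ?q ?u (E i)) (H j ?q))"
      by (intro sum.cong refl)
        (simp add: metric_scale_left[OF q] metric_scale_right[OF q] metric_add_left[OF q] T DE
          tangent_scale tangent_add algebra_simps)
    finally have 1: "\<alpha> ?q v (W t) = \<dots>" .
    have "\<alpha> ?q (V t) w = (\<Sum>i<m. \<Sum>j<n.
        \<alpha> ?q (a i t *\<^sub>R E i ?q) (b' j *\<^sub>R H j ?q + b j t *\<^sub>R D ?q ?u (H j)))"
      unfolding w Vt by (rule metric_sum_sum[OF q]) (auto intro: tangent_scale tangent_add T DH)
    also have "\<dots> = (\<Sum>i<m. \<Sum>j<n. a i t * b' j * \<alpha> ?q (E i ?q) (H j ?q)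
        + a i t * b j t * \<alpha> ?q (E i ?q) (D ?q ?u (H j)))"
      by (intro sum.cong refl)
        (simp add: metric_scale_left[OF q] metric_scale_right[OF q] metric_add_right[OF q] T DH
          tangent_scale tangent_add algebra_simps)
    finally have 2: "\<alpha> ?q (V t) w = \<dots>" .
    show ?thesis
      unfolding 1 2 sum.distrib[symmetric] by (intro sum.cong refl) (simp add: algebra_simps)
  qed
  ultimately have "((\<lambda>s. \<Sum>i<m. \<Sum>j<n. a i s * b j s * \<alpha> (\<gamma> s) (E i (\<gamma> s)) (H j (\<gamma> s)))
    has_real_derivative \<alpha> ?q v (W t) + \<alpha> ?q (V t) w) (at t)"
    by (simp only:)
  then show ?thesis by (subst DERIV_cong_ev[OF refl eq refl])
qed

end

context metric_one_form
begin

lemma compatible_if_parallel: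
  assumes D: "linear_connection M A D" "metric_connection M A \<alpha> D"
    and parallel: "\<And>p v. p \<in> topspace M \<Longrightarrow> v \<in> tangent_space A p \<Longrightarrow> D p v (sharp A \<alpha> \<beta>) = 0"
  shows "compatible M A (randers \<alpha> \<beta>) D"
  unfolding compatible_def parallel_transport_def
proof (intro allI impI, elim conjE exE)
  fix I \<gamma> s t v w V
  assume \<gamma>: "smooth_curve M A I \<gamma>" and s: "s \<in> I" and t: "t \<in> I"
    and V: "parallel_along M A D I \<gamma> V" and v: "V s = v" and w: "V t = w"
  let ?b = "sharp A \<alpha> \<beta>"
  have VT: "V r \<in> tangent_space A (\<gamma> r)" and cov: "has_covariant_derivative M A D \<gamma> V r 0" if "r \<in> I" for r
    using V[unfolded parallel_along_def, rule_format, OF that] by simp_all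
  have convex: "convex I" using \<gamma> is_interval_convex unfolding smooth_curve_def by blast
  have "((\<lambda>r. \<alpha> (\<gamma> r) (V r) (V r)) has_real_derivative 0) (at r within I)" if r: "r \<in> I" for r
  proof -
    have "((\<lambda>r. \<alpha> (\<gamma> r) (V r) (V r)) has_real_derivative \<alpha> (\<gamma> r) 0 (V r) + \<alpha> (\<gamma> r) (V r) 0) (at r)"
      by (rule metric_covariant_derivative[OF D \<gamma> r cov[OF r] cov[OF r]])
    then show ?thesis
      using curve_in_topspace[OF \<gamma> r] VT[OF r]
      by (simp add: metric_zero_left metric_zero_right has_field_derivative_at_within)
  qed
  then have "\<exists>k. \<forall>r\<in>I. \<alpha> (\<gamma> r) (V r) (V r) = k"
    by (rule has_field_derivative_zero_constant[OF convex])
  then obtain k where k: "\<And>r. r \<in> I \<Longrightarrow> \<alpha> (\<gamma> r) (V r) (V r) = k" by blast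
  have "((\<lambda>r. \<alpha> (\<gamma> r) (?b (\<gamma> r)) (V r)) has_real_derivative 0) (at r within I)" if r: "r \<in> I" for r
  proof -
    note top = curve_in_topspace[OF \<gamma> r]
    \<comment> \<open>Restricted to the curve, the dual field is itself parallel, so the product
      rule can be applied to it and \<open>V\<close>.\<close>
    have "has_covariant_derivative M A D \<gamma> (\<lambda>r. ?b (\<gamma> r)) r (D (\<gamma> r) (velocity A \<gamma> r) ?b)"
      by (rule has_covariant_derivative_vfield[where X = ?b and \<gamma> = \<gamma> and t = r, OF sharp_smooth top])
    then have "has_covariant_derivative M A D \<gamma> (\<lambda>r. ?b (\<gamma> r)) r 0"
      by (simp only: parallel[OF top velocity_in_tangent_space[OF \<gamma> r]])
    then have "((\<lambda>r. \<alpha> (\<gamma> r) (?b (\<gamma> r)) (V r)) has_real_derivative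
        \<alpha> (\<gamma> r) 0 (V r) + \<alpha> (\<gamma> r) (?b (\<gamma> r)) 0) (at r)"
      by (rule metric_covariant_derivative[OF D \<gamma> r _ cov[OF r]])
    then show ?thesis
      using top VT[OF r] sharp_tangent[OF top]
      by (simp add: metric_zero_left metric_zero_right has_field_derivative_at_within)
  qed
  then have "\<exists>l. \<forall>r\<in>I. \<alpha> (\<gamma> r) (?b (\<gamma> r)) (V r) = l"
    by (rule has_field_derivative_zero_constant[OF convex])
  then obtain l where l: "\<And>r. r \<in> I \<Longrightarrow> \<alpha> (\<gamma> r) (?b (\<gamma> r)) (V r) = l" by blast
  have "randers \<alpha> \<beta> (\<gamma> r) (V r) = sqrt k + l" if r: "r \<in> I" for r
    using k[OF r] l[OF r] metric_sharp[OF curve_in_topspace[OF \<gamma> r] VT[OF r]] by (simp add: randers_def)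
  then show "randers \<alpha> \<beta> (\<gamma> t) w = randers \<alpha> \<beta> (\<gamma> s) v" using s t v w by auto
qed

subsection \<open>The connection obtained from the Levi-Civita connection\<close>

context
  fixes LC K
  assumes LC: "linear_connection M A LC" and LC_metric: "metric_connection M A \<alpha> LC" and K: "0 < K"
    and norm_sharp: "\<And>p. p \<in> topspace M \<Longrightarrow> \<alpha> p (sharp A \<alpha> \<beta> p) (sharp A \<alpha> \<beta> p) = K\<^sup>2"
begin

abbreviation (input) "bs \<equiv> sharp A \<alpha> \<beta>"
abbreviation (input) "diff_tensor \<equiv> difference_tensor \<alpha> bs LC K"
abbreviation (input) "modified \<equiv> \<lambda>p v Y. LC p v Y + diff_tensor p v (Y p)"

lemma covariant_sharp_tangent:
  "p \<in> topspace M \<Longrightarrow> v \<in> tangent_space A p \<Longrightarrow> LC p v bs \<in> tangent_space A p"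
  by (rule connection_tangent[OF LC sharp_smooth])

text \<open>Differentiating the constant \<open>K\<^sup>2\<close> gives twice this product, by the
  metric property and symmetry.\<close>

lemma covariant_sharp_orthogonal:
  assumes p: "p \<in> topspace M" and v: "v \<in> tangent_space A p"
  shows "\<alpha> p (LC p v bs) (bs p) = 0"
proof -
  have "dir_deriv A p v (\<lambda>q. \<alpha> q (bs q) (bs q)) = 0"
    by (rule dir_deriv_const[OF openin_topspace p norm_sharp])
  moreover have "dir_deriv A p v (\<lambda>q. \<alpha> q (bs q) (bs q)) = \<alpha> p (LC p v bs) (bs p) + \<alpha> p (bs p) (LC p v bs)"
    by (rule metric_connectionD[OF LC_metric sharp_smooth sharp_smooth p v])
  ultimately show ?thesis
    using metric_sym[OF p sharp_tangent[OF p] covariant_sharp_tangent[OF p v]] by simp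
qed

lemma pointwise_solution_sharp_iff:
  assumes p: "p \<in> topspace M"
  shows "pointwise_solution A \<alpha> bs LC p T \<longleftrightarrow>
    (\<forall>x\<in>tangent_space A p. \<forall>y\<in>tangent_space A p. T x y = diff_tensor p x y)"
  by (rule pointwise_solution_iff[where b = bs and K = K and W = LC, OF p K sharp_tangent[OF p] norm_sharp[OF p]
        covariant_sharp_tangent[OF p] connection_linear_on[OF LC sharp_smooth p]
        covariant_sharp_orthogonal[OF p]])

lemma diff_tensor_tangent:
  assumes p: "p \<in> topspace M" and v: "v \<in> tangent_space A p"
  shows "diff_tensor p v y \<in> tangent_space A p"
  by (rule difference_tensor_tangent[where b = bs and K = K and W = LC, OF p K sharp_tangent[OF p] norm_sharp[OF p]
        covariant_sharp_tangent[OF p] connection_linear_on[OF LC sharp_smooth p]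
        covariant_sharp_orthogonal[OF p] v])

lemma diff_tensor_skew:
  assumes p: "p \<in> topspace M" and v: "v \<in> tangent_space A p" and y: "y \<in> tangent_space A p"
    and z: "z \<in> tangent_space A p"
  shows "\<alpha> p (diff_tensor p v y) z = - \<alpha> p (diff_tensor p v z) y"
  by (rule difference_tensor_skew[where b = bs and K = K and W = LC, OF p K sharp_tangent[OF p] norm_sharp[OF p]
        covariant_sharp_tangent[OF p] connection_linear_on[OF LC sharp_smooth p]
        covariant_sharp_orthogonal[OF p] v y z])

lemma diff_tensor_sharp:
  assumes p: "p \<in> topspace M" and v: "v \<in> tangent_space A p"
  shows "diff_tensor p v (bs p) = - LC p v bs"
  by (rule difference_tensor_sharp[where b = bs and K = K and W = LC, OF p K sharp_tangent[OF p] norm_sharp[OF p]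
        covariant_sharp_tangent[OF p] connection_linear_on[OF LC sharp_smooth p]
        covariant_sharp_orthogonal[OF p] v])

lemma diff_tensor_linear_right:
  assumes p: "p \<in> topspace M" and v: "v \<in> tangent_space A p"
  shows "linear_on (tangent_space A p) (diff_tensor p v)"
  by (rule linear_on_difference_tensor_right[where b = bs and K = K and W = LC, OF p K sharp_tangent[OF p] norm_sharp[OF p]
        covariant_sharp_tangent[OF p] connection_linear_on[OF LC sharp_smooth p]
        covariant_sharp_orthogonal[OF p] v])

lemma diff_tensor_linear_left:
  assumes p: "p \<in> topspace M" and y: "y \<in> tangent_space A p"
  shows "linear_on (tangent_space A p) (\<lambda>v. diff_tensor p v y)"
  by (rule linear_on_difference_tensor_left[where b = bs and K = K and W = LC, OF p K sharp_tangent[OF p] norm_sharp[OF p]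
        covariant_sharp_tangent[OF p] connection_linear_on[OF LC sharp_smooth p]
        covariant_sharp_orthogonal[OF p] y])

lemma diff_tensor_smooth:
  assumes X: "smooth_vfield M A U X" and Y: "smooth_vfield M A U Y"
  shows "smooth_vfield M A U (\<lambda>p. diff_tensor p (X p) (Y p))"
proof -
  have U: "openin M U" by (rule smooth_vfield_openin[OF X])
  have b: "smooth_vfield M A U bs"
    by (rule smooth_vfield_subset[OF sharp_smooth U openin_subset[OF U]])
  have Db: "smooth_vfield M A U (\<lambda>p. LC p (X p) bs)" by (rule connection_smooth[OF LC X b])
  have "smooth_vfield M A U (\<lambda>p. (1 / K\<^sup>2 * \<alpha> p (LC p (X p) bs) (Y p)) *\<^sub>R bs p
      - (1 / K\<^sup>2 * \<alpha> p (Y p) (bs p)) *\<^sub>R LC p (X p) bs)"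
    by (intro smooth_vfield_diff smooth_vfield_scale smooth_fun_mult smooth_fun_const metric_smooth U b Db Y)
  then show ?thesis by (simp add: difference_tensor_def)
qed

text \<open>The added term depends on \<open>Y\<close> only through \<open>Y p\<close>, and
  linearly. Hence it respects germs and contributes no derivative to the Leibniz rule: connections
  form an affine space over the tensors of type (1,2).\<close>

lemma linear_connection_modified: "linear_connection M A modified"
  unfolding linear_connection_def
proof (intro conjI allI impI ballI; elim conjE)
  fix U p X v assume X: "smooth_vfield M A U X" and p: "p \<in> U" and v: "v \<in> tangent_space A p"
  show "LC p v X + diff_tensor p v (X p) \<in> tangent_space A p"
    by (intro tangent_add connection_tangent[OF LC X p v] diff_tensor_tangent smooth_vfield_topspace[OF X p] v)
next
  fix U p X assume X: "smooth_vfield M A U X" and p: "p \<in> U"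
  show "linear_on (tangent_space A p) (\<lambda>v. LC p v X + diff_tensor p v (X p))"
    using connection_linear_on[OF LC X p]
      diff_tensor_linear_left[OF smooth_vfield_topspace[OF X p] smooth_vfield_tangent[OF X p]]
    unfolding linear_on_def by (simp add: scaleR_add_right)
next
  fix U p X Y v assume X: "smooth_vfield M A U X" and Y: "smooth_vfield M A U Y" and p: "p \<in> U"
    and v: "v \<in> tangent_space A p"
  have "diff_tensor p v (X p + Y p) = diff_tensor p v (X p) + diff_tensor p v (Y p)"
    using diff_tensor_linear_right[OF smooth_vfield_topspace[OF X p] v]
      smooth_vfield_tangent[OF X p] smooth_vfield_tangent[OF Y p]
    unfolding linear_on_def by blast
  then show "LC p v (\<lambda>q. X q + Y q) + diff_tensor p v (X p + Y p)
      = LC p v X + diff_tensor p v (X p) + (LC p v Y + diff_tensor p v (Y p))"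
    by (simp only: connection_add[OF LC X Y p v] add_ac)
next
  fix U p X Y v assume X: "smooth_vfield M A U X" and Y: "smooth_vfield M A U Y" and p: "p \<in> U"
    and eq: "\<forall>q\<in>U. X q = Y q" and v: "v \<in> tangent_space A p"
  show "LC p v X + diff_tensor p v (X p) = LC p v Y + diff_tensor p v (Y p)"
    by (simp only: connection_local[OF LC X Y p eq v] eq[rule_format, OF p])
next
  fix U p f X v assume f: "smooth_fun M A U f" and X: "smooth_vfield M A U X" and p: "p \<in> U"
    and v: "v \<in> tangent_space A p"
  have "diff_tensor p v (f p *\<^sub>R X p) = f p *\<^sub>R diff_tensor p v (X p)"
    using diff_tensor_linear_right[OF smooth_vfield_topspace[OF X p] v] smooth_vfield_tangent[OF X p]
    unfolding linear_on_def by blast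
  then show "LC p v (\<lambda>q. f q *\<^sub>R X q) + diff_tensor p v (f p *\<^sub>R X p)
      = dir_deriv A p v f *\<^sub>R X p + f p *\<^sub>R (LC p v X + diff_tensor p v (X p))"
    by (simp only: connection_leibniz[OF LC f X p v] scaleR_add_right add_ac)
next
  fix U X Y assume "smooth_vfield M A U X" "smooth_vfield M A U Y"
  then show "smooth_vfield M A U (\<lambda>p. LC p (X p) Y + diff_tensor p (X p) (Y p))"
    by (intro smooth_vfield_add connection_smooth[OF LC] diff_tensor_smooth)
qed

text \<open>Skewness of the tensor is exactly the cancellation of the two terms that it adds to the
  metric property.\<close>

lemma metric_connection_modified: "metric_connection M A \<alpha> modified"
  unfolding metric_connection_def
proof (intro allI impI ballI; elim conjE)
  fix U p X Y v assume X: "smooth_vfield M A U X" and Y: "smooth_vfield M A U Y" and p: "p \<in> U"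
    and v: "v \<in> tangent_space A p"
  note top = smooth_vfield_topspace[OF X p]
  note T = smooth_vfield_tangent[OF X p] smooth_vfield_tangent[OF Y p]
    connection_tangent[OF LC X p v] connection_tangent[OF LC Y p v] diff_tensor_tangent[OF top v]
  have "dir_deriv A p v (\<lambda>q. \<alpha> q (X q) (Y q)) = \<alpha> p (LC p v X) (Y p) + \<alpha> p (X p) (LC p v Y)"
    by (rule metric_connectionD[OF LC_metric X Y p v])
  moreover have "\<alpha> p (X p) (diff_tensor p v (Y p)) = - \<alpha> p (diff_tensor p v (X p)) (Y p)"
    using diff_tensor_skew[OF top v T(1,2)] metric_sym[OF top T(1) T(5)] by simp
  ultimately show "dir_deriv A p v (\<lambda>q. \<alpha> q (X q) (Y q))
      = \<alpha> p (LC p v X + diff_tensor p v (X p)) (Y p) + \<alpha> p (X p) (LC p v Y + diff_tensor p v (Y p))"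
    by (simp only: metric_add_left[OF top T(3,5,2)] metric_add_right[OF top T(4,5,1)])
qed

text \<open>The constraint on the value at the dual field says precisely that this field is parallel
  for the modified connection.\<close>

lemma compatible_modified: "compatible M A (randers \<alpha> \<beta>) modified"
proof (rule compatible_if_parallel[OF linear_connection_modified metric_connection_modified])
  show "LC p v bs + diff_tensor p v (bs p) = 0" if "p \<in> topspace M" "v \<in> tangent_space A p" for p v
    by (simp only: diff_tensor_sharp[OF that] right_minus)
qed

end

end

section \<open>Compatible connections force constant length\<close>

text \<open>Comparing \<open>v\<close> with \<open>- v\<close> separates the even norm from the odd
  inner product. So \<open>L\<close> is orthogonal and its adjoint takes \<open>b'\<close> to
  \<open>b\<close>. Cauchy-Schwarz, applied at a preimage of \<open>b'\<close> and at
  \<open>b\<close>, gives the two inequalities between the lengths.\<close>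

lemma norm_plus_inner_preserving:
  fixes L :: "'e::euclidean_space \<Rightarrow> 'e"
  assumes lin: "linear L" and eq: "\<And>v. norm (L v) + b' \<bullet> L v = norm v + b \<bullet> v"
  shows "b' \<bullet> b' = b \<bullet> b"
proof -
  have neg: "L (- v) = - L v" for v by (rule linear_neg[OF lin])
  have nrm: "norm (L v) = norm v" and inn: "b' \<bullet> L v = b \<bullet> v" for v
    using eq[of v] eq[of "- v"] by (simp_all add: neg)
  have orth: "orthogonal_transformation L"
    unfolding orthogonal_transformation using lin nrm by blast
  then obtain v where v: "L v = b'" using orthogonal_transformation_surj by (metis surjD)
  have "norm v = norm b'" using nrm[of v] v by simp
  moreover have "norm b' * norm b' = b \<bullet> v"
    using inn[of v] v by (simp add: dot_square_norm power2_eq_square)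
  ultimately have "norm b' * norm b' \<le> norm b * norm b'"
    using norm_cauchy_schwarz[of b v] by simp
  then have "norm b' \<le> norm b" by (cases "norm b' = 0") (auto simp: mult_le_cancel_right)
  moreover have "norm b * norm b \<le> norm b' * norm b"
    using inn[of b] norm_cauchy_schwarz[of b' "L b"] nrm[of b] by (simp add: dot_square_norm power2_eq_square)
  then have "norm b \<le> norm b'" by (cases "norm b = 0") (auto simp: mult_le_cancel_right)
  ultimately show ?thesis by (simp add: dot_square_norm)
qed

section \<open>Straight lines of a chart as curves in the manifold\<close>

context manifold
begin

context
  fixes c x w and I :: "real set"
  assumes c: "c \<in> A" and I: "open I" "is_interval I"
    and segment: "\<And>t. t \<in> I \<Longrightarrow> x + t *\<^sub>R w \<in> snd c ` fst c"
begin

abbreviation (input) "line t \<equiv> chart_inv c (x + t *\<^sub>R w)"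

lemma line_in_chart: "t \<in> I \<Longrightarrow> line t \<in> fst c"
  using segment c by force

lemma chart_line: "t \<in> I \<Longrightarrow> snd c (line t) = x + t *\<^sub>R w"
  using segment c by force

lemma smooth_curve_line: "smooth_curve M A I (\<lambda>t. line t)"
  unfolding smooth_curve_def
proof (intro conjI ballI)
  have aff: "continuous_map (top_of_set I) (top_of_set (snd c ` fst c)) (\<lambda>t. x + t *\<^sub>R w)"
    using segment by (auto intro!: continuous_intros)
  have "continuous_map (top_of_set I) M (chart_inv c \<circ> (\<lambda>t. x + t *\<^sub>R w))"
    by (rule continuous_map_compose[OF aff continuous_map_chart_inv[OF c]])
  then show cont: "continuous_map (top_of_set I) M (\<lambda>t. line t)" by (simp add: comp_def)
  fix d assume d: "d \<in> A"
  let ?S = "{t \<in> I. line t \<in> fst d}"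
  have "openin (top_of_set I) ?S"
    using cont openin_chart[OF d] unfolding continuous_map_def by simp
  then have S: "open ?S" using I(1) openin_open_trans by blast
  have "smooth_on ?S (\<lambda>t. x + t *\<^sub>R w)"
    by (intro smooth_on_add S smooth_on_const smooth_on_bounded_linear bounded_linear_scaleR_left)
  then have "smooth_on ?S ((snd d \<circ> chart_inv c) \<circ> (\<lambda>t. x + t *\<^sub>R w))"
  proof (rule smooth_on_compose[OF S smooth_on_transition[OF c d]])
    show "(\<lambda>t. x + t *\<^sub>R w) ` ?S \<subseteq> snd c ` (fst c \<inter> fst d)"
    proof
      fix y assume "y \<in> (\<lambda>t. x + t *\<^sub>R w) ` ?S"
      then obtain t where t: "t \<in> I" "line t \<in> fst d" "y = x + t *\<^sub>R w" by blast
      then have "y = snd c (line t)" using chart_line by simp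
      then show "y \<in> snd c ` (fst c \<inter> fst d)" using t line_in_chart by blast
    qed
  qed
  then show "smooth_on ?S (snd d \<circ> (\<lambda>t. line t))" by (simp add: comp_def)
qed (rule I)+

text \<open>Along a coordinate line the velocity is the restriction of a smooth field on the whole
  chart domain. The coefficients of the parallel equation thereby become smooth functions on that
  domain, evaluated along the line.\<close>

lemma velocity_line:
  assumes t: "t \<in> I"
  shows "velocity A (\<lambda>t. line t) t = lift c (line t) w"
proof (rule tangent_space_eqI[OF velocity_in_tangent_space[OF smooth_curve_line t]
      lift_in_tangent_space[OF c line_in_chart[OF t]] c line_in_chart[OF t]])
  have "((\<lambda>t. x + t *\<^sub>R w) has_vector_derivative w) (at t)"
    by (auto intro!: derivative_eq_intros)
  then have "(snd c \<circ> (\<lambda>t. line t) has_vector_derivative w) (at t)"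
    by (rule has_vector_derivative_transform_within_open[OF _ I(1) t]) (simp add: chart_line)
  then have "velocity A (\<lambda>t. line t) t c = w"
    using curve_has_vector_derivative[OF smooth_curve_line t c line_in_chart[OF t]]
      vector_derivative_unique_at by blast
  then show "velocity A (\<lambda>t. line t) t c = lift c (line t) w c"
    using c line_in_chart[OF t] by simp
qed

end

end

context riemannian_manifold
begin

text \<open>In an orthonormal frame, a field along a line in a chart is parallel iff its coordinates solve a
  linear differential equation.\<close>

lemma parallel_fields_along_line:
  assumes D: "linear_connection M A D" and c: "c \<in> A" and x: "x \<in> snd c ` fst c"
    and frame: "orthonormal_frame (fst c) e"
  obtains \<delta> Z where "0 < \<delta>" "\<And>t. t \<in> {-\<delta><..<\<delta>} \<Longrightarrow> x + t *\<^sub>R w \<in> snd c ` fst c"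
    "\<And>t. linear (\<lambda>v. Z v t)" "\<And>v. Z v 0 = v"
    "\<And>v. parallel_along M A D {-\<delta><..<\<delta>} (\<lambda>t. chart_inv c (x + t *\<^sub>R w))
      (\<lambda>t. frame_map e (chart_inv c (x + t *\<^sub>R w)) (Z v t))"
proof -
  let ?O = "snd c ` fst c"
  define \<gamma> where "\<gamma> t = chart_inv c (x + t *\<^sub>R w)" for t
  have "open ((\<lambda>t. x + t *\<^sub>R w) -` ?O)"
    by (intro open_vimage open_chart_image_chart[OF c] continuous_intros)
  moreover have "0 \<in> (\<lambda>t::real. x + t *\<^sub>R w) -` ?O" using x by simp
  \<comment> \<open>A closed ball is taken because compactness of \<open>{-d..d}\<close> will bound
    the coefficients.\<close>
  ultimately obtain d where d: "0 < d" and "cball 0 d \<subseteq> (\<lambda>t. x + t *\<^sub>R w) -` ?O"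
    using open_contains_cball by metis
  then have seg: "x + t *\<^sub>R w \<in> ?O" if "t \<in> {-d..d}" for t
    using that by (auto simp: subset_iff)
  \<comment> \<open>Connection coefficients of the frame in the constant direction \<open>w\<close>:
    the \<open>e i\<close>-component of the derivative of \<open>e j\<close>.\<close>
  define G where "G i j p = \<alpha> p (D p (lift c p w) (e j)) (e i p)" for i j p
  have G_smooth: "smooth_fun M A (fst c) (G i j)" if "i \<in> Basis" "j \<in> Basis" for i j
    unfolding G_def[abs_def]
    by (intro metric_smooth connection_smooth[OF D] smooth_vfield_lift c frame_smooth[OF frame] that)
  have G_cont: "continuous_on {-d..d} (\<lambda>t. G i j (\<gamma> t))" if "i \<in> Basis" "j \<in> Basis" for i j
  proof -
    have "continuous_on ?O (\<lambda>x. G i j (chart_inv c x))"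
      using smooth_on_imp_continuous_on[OF smooth_funD[OF G_smooth[OF that] c]] by simp
    then have "continuous_on {-d..d} (\<lambda>t. G i j (chart_inv c (x + t *\<^sub>R w)))"
      by (rule continuous_on_compose2) (use seg in \<open>auto intro!: continuous_intros\<close>)
    then show ?thesis by (simp add: \<gamma>_def)
  qed
  \<comment> \<open>A field with frame coordinates \<open>y\<close> has covariant derivative zero
    when \<open>y' = f t y\<close>: the derivatives of the coordinates must cancel the contribution
    of the frame.\<close>
  define f where "f t y = - (\<Sum>i\<in>Basis. (\<Sum>j\<in>Basis. (y \<bullet> j) * G i j (\<gamma> t)) *\<^sub>R i)" for t and y :: 'e
  have f_lin: "linear (f t)" for t
    unfolding f_def
    by (rule linearI) (simp_all add: inner_add_left distrib_right sum.distrib scaleR_add_left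
        sum_distrib_left mult.assoc scaleR_sum_right)
  have f_cont: "continuous_on ({-d..d} \<times> UNIV) (\<lambda>(t, y). f t y)"
  proof -
    have "continuous_on ({-d..d} \<times> UNIV) (\<lambda>z::real \<times> 'e. G i j (\<gamma> (fst z)))"
      if "i \<in> Basis" "j \<in> Basis" for i j
      by (rule continuous_on_compose2[OF G_cont[OF that] continuous_on_fst[OF continuous_on_id]]) auto
    then have "continuous_on ({-d..d} \<times> UNIV) (\<lambda>z::real \<times> 'e. f (fst z) (snd z))"
      unfolding f_def by (intro continuous_intros) auto
    then show ?thesis by (simp add: case_prod_beta)
  qed
  \<comment> \<open>The sum of the absolute values of all entries dominates the operator norm of
    \<open>f t\<close>; its bound on the compact interval is the Lipschitz constant.\<close>
  define H where "H t = (\<Sum>i\<in>Basis. \<Sum>j\<in>Basis. \<bar>G i j (\<gamma> t)\<bar>)" for t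
  have "continuous_on {-d..d} H"
    unfolding H_def[abs_def] by (intro continuous_intros G_cont)
  then have "bounded (H ` {-d..d})"
    by (intro compact_imp_bounded compact_continuous_image) auto
  then obtain L where L: "\<And>t. t \<in> {-d..d} \<Longrightarrow> H t \<le> L"
    unfolding bounded_iff by (metis abs_le_D1 image_eqI real_norm_def)
  have f_lip: "norm (f t y - f t z) \<le> L * norm (y - z)" if t: "t \<in> {-d..d}" for t y z
  proof -
    have "norm (f t y - f t z) = norm (f t (y - z))" by (simp only: linear_diff[OF f_lin])
    also have "\<dots> \<le> (\<Sum>i\<in>Basis. norm ((\<Sum>j\<in>Basis. ((y - z) \<bullet> j) * G i j (\<gamma> t)) *\<^sub>R i))"
      unfolding f_def norm_minus_cancel by (rule norm_sum)
    also have "\<dots> \<le> (\<Sum>i\<in>Basis. \<Sum>j\<in>Basis. norm (y - z) * \<bar>G i j (\<gamma> t)\<bar>)"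
    proof (rule sum_mono)
      fix i :: 'e assume i: "i \<in> Basis"
      have "norm ((\<Sum>j\<in>Basis. ((y - z) \<bullet> j) * G i j (\<gamma> t)) *\<^sub>R i)
          = \<bar>\<Sum>j\<in>Basis. ((y - z) \<bullet> j) * G i j (\<gamma> t)\<bar>"
        using i by simp
      also have "\<dots> \<le> (\<Sum>j\<in>Basis. \<bar>((y - z) \<bullet> j) * G i j (\<gamma> t)\<bar>)" by (rule sum_abs)
      also have "\<dots> \<le> (\<Sum>j\<in>Basis. norm (y - z) * \<bar>G i j (\<gamma> t)\<bar>)"
        by (rule sum_mono) (auto simp: abs_mult intro!: mult_right_mono Basis_le_norm)
      finally show "norm ((\<Sum>j\<in>Basis. ((y - z) \<bullet> j) * G i j (\<gamma> t)) *\<^sub>R i)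
        \<le> (\<Sum>j\<in>Basis. norm (y - z) * \<bar>G i j (\<gamma> t)\<bar>)" .
    qed
    also have "\<dots> = norm (y - z) * H t" by (simp add: H_def sum_distrib_left)
    also have "\<dots> \<le> norm (y - z) * L" by (rule mult_left_mono[OF L[OF t]]) simp
    finally show ?thesis by (simp add: mult.commute)
  qed
  obtain \<delta> where \<delta>: "0 < \<delta>" "\<delta> \<le> d"
    and sol: "\<And>v. \<exists>y. y 0 = v \<and> (\<forall>t\<in>{-\<delta><..<\<delta>}. (y has_vector_derivative f t (y t)) (at t))"
    using picard_lindelof[OF d f_cont f_lip] by metis
  then obtain Y where Y0: "\<And>v. Y v 0 = v"
    and Y: "\<And>v t. t \<in> {-\<delta><..<\<delta>} \<Longrightarrow> (Y v has_vector_derivative f t (Y v t)) (at t)"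
    by metis
  \<comment> \<open>\<open>Y v\<close> is an arbitrary choice of a solution for each
    \<open>v\<close>, and no uniqueness has been established, so it is not known to be linear in
    \<open>v\<close>. Superposing the solutions that start in \<open>Basis\<close> gives linearity
    by construction.\<close>
  define Z where "Z v t = (\<Sum>b\<in>Basis. (v \<bullet> b) *\<^sub>R Y b t)" for v t
  have Z_lin: "linear (\<lambda>v. Z v t)" for t
    unfolding Z_def
    by (rule linearI) (simp_all add: inner_add_left scaleR_add_left sum.distrib scaleR_sum_right)
  have Z0: "Z v 0 = v" for v by (simp add: Z_def Y0 euclidean_representation)
  have Z: "(Z v has_vector_derivative f t (Z v t)) (at t)" if t: "t \<in> {-\<delta><..<\<delta>}" for v t
  proof -
    have "((\<lambda>t. \<Sum>b\<in>Basis. (v \<bullet> b) *\<^sub>R Y b t) has_vector_derivative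
      (\<Sum>b\<in>Basis. (v \<bullet> b) *\<^sub>R f t (Y b t))) (at t)"
      by (intro has_vector_derivative_sum
          bounded_linear.has_vector_derivative[OF bounded_linear_scaleR_right] Y t)
    also have "(\<Sum>b\<in>Basis. (v \<bullet> b) *\<^sub>R f t (Y b t)) = f t (Z v t)"
      by (simp only: Z_def linear_sum[OF f_lin] linear_scale[OF f_lin])
    finally show ?thesis by (simp add: Z_def[abs_def])
  qed
  let ?I = "{-\<delta><..<\<delta>}"
  have segI: "x + t *\<^sub>R w \<in> ?O" if "t \<in> ?I" for t using seg that \<delta> by auto
  have intI: "open ?I" "is_interval ?I" by (auto simp: is_interval_oo)
  have \<gamma>_chart: "\<gamma> t \<in> fst c" if "t \<in> ?I" for t
    unfolding \<gamma>_def by (rule line_in_chart[OF c intI segI that])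
  have vel: "velocity A \<gamma> t = lift c (\<gamma> t) w" if "t \<in> ?I" for t
    unfolding \<gamma>_def[abs_def] by (rule velocity_line[OF c intI segI that])
  \<comment> \<open>Frames are indexed by \<open>Basis\<close>, but
    \<open>has_covariant_derivative\<close> asks for an initial segment of the natural
    numbers.\<close>
  obtain \<pi> where \<pi>: "bij_betw \<pi> {..<DIM('e)} (Basis :: 'e set)"
    using ex_bij_betw_nat_finite[OF finite_Basis] by (auto simp: atLeast0LessThan)
  have \<pi>_Basis: "\<pi> k \<in> Basis" if "k < DIM('e)" for k using \<pi> that by (auto dest: bij_betwE)
  have parallel: "parallel_along M A D ?I \<gamma> (\<lambda>t. frame_map e (\<gamma> t) (Z v t))" for v
    unfolding parallel_along_def
  proof (intro ballI conjI)
    fix t assume t: "t \<in> ?I"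
    note q = \<gamma>_chart[OF t]
    show "frame_map e (\<gamma> t) (Z v t) \<in> tangent_space A (\<gamma> t)"
      by (rule frame_map_tangent[OF frame q])
    let ?z' = "f t (Z v t)"
    let ?D = "\<lambda>j. D (\<gamma> t) (velocity A \<gamma> t) (e j)"
    have D_frame: "?D j = (\<Sum>i\<in>Basis. G i j (\<gamma> t) *\<^sub>R e i (\<gamma> t))" if j: "j \<in> Basis" for j
      unfolding vel[OF t] G_def
      by (rule frame_expansion[OF frame q connection_tangent[OF D frame_smooth[OF frame j] q
              lift_in_tangent_space[OF c q]]])
    have "(\<Sum>j\<in>Basis. (Z v t \<bullet> j) *\<^sub>R ?D j)
        = (\<Sum>j\<in>Basis. \<Sum>i\<in>Basis. ((Z v t \<bullet> j) * G i j (\<gamma> t)) *\<^sub>R e i (\<gamma> t))"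
      by (rule sum.cong) (simp_all only: D_frame scaleR_sum_right scaleR_scaleR)
    also have "\<dots> = (\<Sum>i\<in>Basis. (\<Sum>j\<in>Basis. (Z v t \<bullet> j) * G i j (\<gamma> t)) *\<^sub>R e i (\<gamma> t))"
      by (subst sum.swap) (simp only: scaleR_left.sum)
    also have "\<dots> = - (\<Sum>i\<in>Basis. (?z' \<bullet> i) *\<^sub>R e i (\<gamma> t))"
    proof -
      have "?z' \<bullet> i = - (\<Sum>j\<in>Basis. (Z v t \<bullet> j) * G i j (\<gamma> t))" if "i \<in> Basis" for i
        using that by (simp add: f_def inner_minus_left inner_sum_left inner_Basis if_distrib cong: if_cong)
      then show ?thesis
        by (subst sum_negf[symmetric], intro sum.cong refl) (simp only: scaleR_minus_left minus_minus)
    qed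
    finally have zero: "(\<Sum>i\<in>Basis. (?z' \<bullet> i) *\<^sub>R e i (\<gamma> t) + (Z v t \<bullet> i) *\<^sub>R ?D i) = 0"
      unfolding sum.distrib by (simp only: right_minus)
    show "has_covariant_derivative M A D \<gamma> (\<lambda>t. frame_map e (\<gamma> t) (Z v t)) t 0"
      unfolding has_covariant_derivative_def
    proof (rule exI[of _ "fst c"], rule exI[of _ "DIM('e)"], rule exI[of _ "\<lambda>k. e (\<pi> k)"],
        rule exI[of _ "\<lambda>k s. Z v s \<bullet> \<pi> k"], rule exI[of _ "\<lambda>k. ?z' \<bullet> \<pi> k"], intro conjI allI impI)
      show "\<gamma> t \<in> fst c" by (rule q)
      show "smooth_vfield M A (fst c) (e (\<pi> k))" if "k < DIM('e)" for k
        by (rule frame_smooth[OF frame \<pi>_Basis[OF that]])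
      show "((\<lambda>s. Z v s \<bullet> \<pi> k) has_real_derivative ?z' \<bullet> \<pi> k) (at t)" for k
        unfolding has_real_derivative_iff_has_vector_derivative
        by (rule bounded_linear.has_vector_derivative[OF bounded_linear_inner_left Z[OF t]])
      have "frame_map e (\<gamma> s) (Z v s) = (\<Sum>k<DIM('e). (Z v s \<bullet> \<pi> k) *\<^sub>R e (\<pi> k) (\<gamma> s))" for s
        unfolding frame_map_def by (rule sum.reindex_bij_betw[OF \<pi>, symmetric])
      then show "\<forall>\<^sub>F s in nhds t. frame_map e (\<gamma> s) (Z v s)
          = (\<Sum>k<DIM('e). (Z v s \<bullet> \<pi> k) *\<^sub>R e (\<pi> k) (\<gamma> s))"
        by (intro always_eventually allI)
      show "0 = (\<Sum>k<DIM('e). (?z' \<bullet> \<pi> k) *\<^sub>R e (\<pi> k) (\<gamma> t) + (Z v t \<bullet> \<pi> k) *\<^sub>R ?D (\<pi> k))"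
        using sum.reindex_bij_betw[OF \<pi>, of "\<lambda>i. (?z' \<bullet> i) *\<^sub>R e i (\<gamma> t) + (Z v t \<bullet> i) *\<^sub>R ?D i"] zero
        by (simp only:)
    qed
  qed
  show thesis
    by (rule that[OF \<delta>(1) segI Z_lin Z0 parallel[unfolded \<gamma>_def[abs_def]]])
qed

end

section \<open>Constancy of the length of the dual field: along lines, locally, globally\<close>

context metric_one_form
begin

abbreviation (input) "sq_length p \<equiv> \<alpha> p (sharp A \<alpha> \<beta> p) (sharp A \<alpha> \<beta> p)"

text \<open>\<open>frame_map\<close> turns \<open>\<alpha>\<close> into the inner product of
  \<open>'e\<close> and the dual field into the vector of its frame coordinates. This gives
  transport the form required by \<open>norm_plus_inner_preserving\<close>.\<close>

lemma randers_frame: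
  assumes frame: "orthonormal_frame U e" and p: "p \<in> U"
  shows "randers \<alpha> \<beta> p (frame_map e p y) = norm y + (\<Sum>i\<in>Basis. \<beta> p (e i p) *\<^sub>R i) \<bullet> y"
    and "sq_length p = (\<Sum>i\<in>Basis. \<beta> p (e i p) *\<^sub>R i) \<bullet> (\<Sum>i\<in>Basis. \<beta> p (e i p) *\<^sub>R i)"
proof -
  note top = frame_topspace[OF frame p]
  let ?b = "\<Sum>i\<in>Basis. \<beta> p (e i p) *\<^sub>R i"
  have "sharp A \<alpha> \<beta> p = frame_map e p ?b"
    unfolding sharp_frame(1)[OF frame p] frame_map_def by (intro sum.cong refl) simp
  note eq = this metric_frame_map[OF frame p]
  show "sq_length p = ?b \<bullet> ?b" by (simp only: eq)
  have "\<beta> p (frame_map e p y) = \<alpha> p (sharp A \<alpha> \<beta> p) (frame_map e p y)"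
    by (rule metric_sharp[OF top frame_map_tangent[OF frame p], symmetric])
  also have "\<dots> = ?b \<bullet> y" by (simp only: eq)
  finally show "randers \<alpha> \<beta> p (frame_map e p y) = norm y + ?b \<bullet> y"
    by (simp add: randers_def eq(2) norm_eq_sqrt_inner)
qed

lemma sq_length_constant_along_line:
  assumes D: "linear_connection M A D" and comp: "compatible M A (randers \<alpha> \<beta>) D"
    and c: "c \<in> A" and x: "x \<in> snd c ` fst c"
  obtains \<delta> where "0 < \<delta>"
    "\<And>t. t \<in> {-\<delta><..<\<delta>} \<Longrightarrow> sq_length (chart_inv c (x + t *\<^sub>R w)) = sq_length (chart_inv c x)"
proof -
  obtain e where frame: "orthonormal_frame (fst c) e" using orthonormal_frame_exists[OF c] by blast
  obtain \<delta> Z where \<delta>: "0 < \<delta>" and seg: "\<And>t. t \<in> {-\<delta><..<\<delta>} \<Longrightarrow> x + t *\<^sub>R w \<in> snd c ` fst c"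
    and Z: "\<And>t. linear (\<lambda>v. Z v t)" "\<And>v. Z v 0 = v"
    and parallel: "\<And>v. parallel_along M A D {-\<delta><..<\<delta>} (\<lambda>t. chart_inv c (x + t *\<^sub>R w))
      (\<lambda>t. frame_map e (chart_inv c (x + t *\<^sub>R w)) (Z v t))"
    by (rule parallel_fields_along_line[OF D c x frame, of w]) blast
  let ?I = "{-\<delta><..<\<delta>}" and ?\<gamma> = "\<lambda>t. chart_inv c (x + t *\<^sub>R w)"
  have intI: "open ?I" "is_interval ?I" by (auto simp: is_interval_oo)
  have curve: "smooth_curve M A ?I ?\<gamma>" by (rule smooth_curve_line[OF c intI seg])
  have chart: "?\<gamma> t \<in> fst c" if "t \<in> ?I" for t by (rule line_in_chart[OF c intI seg that])
  have zero: "0 \<in> ?I" using \<delta> by simp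
  have "sq_length (?\<gamma> t) = sq_length (?\<gamma> 0)" if t: "t \<in> ?I" for t
    unfolding randers_frame(2)[OF frame chart[OF t]] randers_frame(2)[OF frame chart[OF zero]]
  \<comment> \<open>At time \<open>t\<close>, \<open>Z\<close> is the parallel transport from 0 to
    \<open>t\<close> written in frame coordinates; it plays the role of \<open>L\<close>.\<close>
  proof (rule norm_plus_inner_preserving[OF Z(1)])
    fix v
    have "parallel_transport M A D ?I ?\<gamma> 0 t (frame_map e (?\<gamma> 0) v) (frame_map e (?\<gamma> t) (Z v t))"
      unfolding parallel_transport_def
      by (rule exI[of _ "\<lambda>t. frame_map e (?\<gamma> t) (Z v t)"]) (simp add: parallel Z(2))
    then have "randers \<alpha> \<beta> (?\<gamma> t) (frame_map e (?\<gamma> t) (Z v t)) = randers \<alpha> \<beta> (?\<gamma> 0) (frame_map e (?\<gamma> 0) v)"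
      using comp[unfolded compatible_def, rule_format, OF conjI[OF curve conjI[OF zero conjI[OF t]]]]
      by blast
    then show "norm (Z v t) + (\<Sum>i\<in>Basis. \<beta> (?\<gamma> t) (e i (?\<gamma> t)) *\<^sub>R i) \<bullet> Z v t
        = norm v + (\<Sum>i\<in>Basis. \<beta> (?\<gamma> 0) (e i (?\<gamma> 0)) *\<^sub>R i) \<bullet> v"
      by (simp only: randers_frame(1)[OF frame chart[OF t]] randers_frame(1)[OF frame chart[OF zero]])
  qed
  then show thesis using that[OF \<delta>] by simp
qed

text \<open>The interval on which a line keeps the length constant depends on the point and the
  direction, so it yields no neighbourhood directly. It does make every directional derivative
  vanish at every point of the chart, and a smooth function with zero derivative is constant on a
  ball.\<close>

lemma sq_length_locally_constant:
  assumes D: "linear_connection M A D" and comp: "compatible M A (randers \<alpha> \<beta>) D"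
    and p: "p \<in> topspace M"
  obtains U where "openin M U" "p \<in> U" "\<And>q. q \<in> U \<Longrightarrow> sq_length q = sq_length p"
proof -
  obtain c where c: "c \<in> A" "p \<in> fst c" using chart_exists[OF p] by blast
  let ?O = "snd c ` fst c" and ?h = "\<lambda>x. sq_length (chart_inv c x)"
  have O: "open ?O" by (rule open_chart_image_chart[OF c(1)])
  have "smooth_fun M A (topspace M) (\<lambda>p. sq_length p)"
    by (rule metric_smooth[OF sharp_smooth sharp_smooth])
  then have "smooth_on (snd c ` (topspace M \<inter> fst c)) ?h" by (rule smooth_funD[OF _ c(1)])
  then have smooth: "smooth_on ?O ?h"
    using openin_subset[OF openin_chart[OF c(1)]] by (simp add: Int_absorb1)
  have deriv: "(?h has_derivative (\<lambda>_. 0)) (at x)" if x: "x \<in> ?O" for x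
  proof -
    let ?D = "frechet_derivative ?h (at x)"
    have hD: "(?h has_derivative ?D) (at x)" by (rule smooth_on_imp_has_derivative[OF smooth x])
    have "?D w = 0" for w
    proof -
      obtain \<delta> where \<delta>: "0 < \<delta>" and const: "\<And>t. t \<in> {-\<delta><..<\<delta>} \<Longrightarrow> ?h (x + t *\<^sub>R w) = ?h x"
        using sq_length_constant_along_line[OF D comp c(1) x, of w] by blast
      have line: "((\<lambda>t. x + t *\<^sub>R w) has_vector_derivative w) (at 0)"
        by (auto intro!: derivative_eq_intros)
      have "(?h has_derivative ?D) (at (x + 0 *\<^sub>R w) within range (\<lambda>t. x + t *\<^sub>R w))"
        using hD by (simp add: has_derivative_at_withinI)
      then have "(?h \<circ> (\<lambda>t. x + t *\<^sub>R w) has_vector_derivative ?D w) (at 0)"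
        by (rule vector_derivative_diff_chain_within[OF line])
      then have "((\<lambda>_. ?h x) has_vector_derivative ?D w) (at 0)"
        by (rule has_vector_derivative_transform_within_open[where S="{-\<delta><..<\<delta>}"])
          (use \<delta> const in auto)
      then show ?thesis
        using vector_derivative_unique_at has_vector_derivative_const by blast
    qed
    then have "?D = (\<lambda>_. 0)" by (rule ext)
    then show ?thesis using hD by simp
  qed
  obtain r where r: "0 < r" "ball (snd c p) r \<subseteq> ?O"
    using O c(2) open_contains_ball by blast
  have "\<exists>k. \<forall>x\<in>ball (snd c p) r. ?h x = k"
    by (rule has_derivative_zero_constant[OF convex_ball])
      (use r deriv in \<open>blast intro: has_derivative_at_withinI\<close>)
  then obtain k where k: "\<And>x. x \<in> ball (snd c p) r \<Longrightarrow> ?h x = k" by blast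
  define U where "U = {q \<in> fst c. snd c q \<in> ball (snd c p) r}"
  have "openin (top_of_set ?O) (ball (snd c p) r)" using r by (auto intro: open_subset)
  then have "openin (subtopology M (fst c)) {q \<in> topspace (subtopology M (fst c)). snd c q \<in> ball (snd c p) r}"
    by (rule openin_continuous_map_preimage[OF homeomorphic_imp_continuous_map[OF homeomorphic_chart[OF c(1)]]])
  also have "{q \<in> topspace (subtopology M (fst c)). snd c q \<in> ball (snd c p) r} = U"
    using openin_subset[OF openin_chart[OF c(1)]] by (auto simp: U_def topspace_subtopology)
  finally have "openin M U" by (rule openin_trans_full[OF _ openin_chart[OF c(1)]])
  moreover have "p \<in> U" using c r by (simp add: U_def)
  moreover have len: "sq_length q = k" if "q \<in> U" for q
    using k[of "snd c q"] that c(1) by (simp add: U_def)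
  then have "sq_length q = sq_length p" if "q \<in> U" for q
    using that \<open>p \<in> U\<close> by simp
  ultimately show thesis by (rule that)
qed

text \<open>Local constancy makes every set cut out by a predicate of the length open; applied to
  the level of \<open>p\<close> and to its negation this gives a clopen set, and connectedness does
  the rest.\<close>

lemma sq_length_constant:
  assumes D: "linear_connection M A D" and comp: "compatible M A (randers \<alpha> \<beta>) D"
    and conn: "connected_space M" and p: "p \<in> topspace M" and q: "q \<in> topspace M"
  shows "sq_length q = sq_length p"
proof -
  have opn: "openin M {q \<in> topspace M. P (sq_length q)}" for P
  proof (subst openin_subopen, intro ballI)
    fix q assume q: "q \<in> {q \<in> topspace M. P (sq_length q)}"
    then have top: "q \<in> topspace M" by simp
    obtain U where U: "openin M U" "q \<in> U" and len: "\<And>r. r \<in> U \<Longrightarrow> sq_length r = sq_length q"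
      by (rule sq_length_locally_constant[OF D comp top]) (rule that)
    then have "U \<subseteq> {q \<in> topspace M. P (sq_length q)}"
    proof (intro subsetI CollectI conjI)
      fix r assume r: "r \<in> U"
      show "r \<in> topspace M" using r openin_subset[OF U(1)] by blast
      show "P (sq_length r)" unfolding len[OF r] using q by blast
    qed
    then show "\<exists>T. openin M T \<and> q \<in> T \<and> T \<subseteq> {q \<in> topspace M. P (sq_length q)}" using U by blast
  qed
  let ?S = "{q \<in> topspace M. sq_length q = sq_length p}"
  have "topspace M - ?S = {q \<in> topspace M. sq_length q \<noteq> sq_length p}" by auto
  then have "openin M ?S \<and> closedin M ?S"
    using opn[of "\<lambda>l. l = sq_length p"] opn[of "\<lambda>l. l \<noteq> sq_length p"] by (simp add: closedin_def)
  then have "?S = {} \<or> ?S = topspace M" using conn connected_space_clopen_in by blast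
  then have "?S = topspace M" using p by auto
  then show ?thesis using q by auto
qed

end

theorem theorem3:
  fixes M :: "'m topology"
    and A :: "('m, 'e::euclidean_space) chart set"
    and \<alpha> :: "'m \<Rightarrow> ('m, 'e) tvec \<Rightarrow> ('m, 'e) tvec \<Rightarrow> real"
    and \<beta> :: "'m \<Rightarrow> ('m, 'e) tvec \<Rightarrow> real"
    and \<beta>s :: "('m, 'e) vfield"
    and F :: "'m \<Rightarrow> ('m, 'e) tvec \<Rightarrow> real"
    and LC :: "('m, 'e) conn"
  assumes "smooth_manifold M A" and "connected_space M"
    and "riemannian_metric M A \<alpha>"
    and "one_form M A \<beta>"
    and "\<beta>s = sharp A \<alpha> \<beta>"
    and "\<forall>p\<in>topspace M. \<alpha> p (\<beta>s p) (\<beta>s p) < 1"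
    and "F = randers \<alpha> \<beta>"
    and "\<exists>p\<in>topspace M. \<exists>v\<in>tangent_space A p. \<beta> p v \<noteq> 0"
    and "levi_civita M A \<alpha> LC"
  shows "((\<exists>D. linear_connection M A D \<and> compatible M A F D) \<longleftrightarrow>
          (\<exists>K>0. \<forall>p\<in>topspace M. \<alpha> p (\<beta>s p) (\<beta>s p) = K\<^sup>2)) \<and>
         (\<forall>K>0. (\<forall>p\<in>topspace M. \<alpha> p (\<beta>s p) (\<beta>s p) = K\<^sup>2) \<longrightarrow>
           (\<forall>p\<in>topspace M. \<forall>T.
              pointwise_solution A \<alpha> \<beta>s LC p T \<longleftrightarrow>
              (\<forall>x\<in>tangent_space A p. \<forall>y\<in>tangent_space A p.
                 T x y = difference_tensor \<alpha> \<beta>s LC K p x y)) \<and>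
           linear_connection M A (\<lambda>p v Y. LC p v Y + difference_tensor \<alpha> \<beta>s LC K p v (Y p)) \<and>
           compatible M A F (\<lambda>p v Y. LC p v Y + difference_tensor \<alpha> \<beta>s LC K p v (Y p)))"
proof -
  interpret metric_one_form M A \<alpha> \<beta>
    by unfold_locales (rule assms)+
  have LC: "linear_connection M A LC" "metric_connection M A \<alpha> LC"
    using assms(9) unfolding levi_civita_def by blast+
  \<comment> \<open>Serves twice: as the second half of the claim and, through the connection that
    it provides, as the sufficiency direction of the equivalence.\<close>
  have modified: "(\<forall>p\<in>topspace M. \<forall>T. pointwise_solution A \<alpha> \<beta>s LC p T \<longleftrightarrow>
        (\<forall>x\<in>tangent_space A p. \<forall>y\<in>tangent_space A p. T x y = difference_tensor \<alpha> \<beta>s LC K p x y)) \<and>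
      linear_connection M A (\<lambda>p v Y. LC p v Y + difference_tensor \<alpha> \<beta>s LC K p v (Y p)) \<and>
      compatible M A F (\<lambda>p v Y. LC p v Y + difference_tensor \<alpha> \<beta>s LC K p v (Y p))"
    if K: "K > 0" and len: "\<forall>p\<in>topspace M. \<alpha> p (\<beta>s p) (\<beta>s p) = K\<^sup>2" for K
  proof (intro conjI ballI allI)
    note len' = len[unfolded assms(5), rule_format]
    show "pointwise_solution A \<alpha> \<beta>s LC p T \<longleftrightarrow>
        (\<forall>x\<in>tangent_space A p. \<forall>y\<in>tangent_space A p. T x y = difference_tensor \<alpha> \<beta>s LC K p x y)"
      if "p \<in> topspace M" for p T
      unfolding assms(5) by (rule pointwise_solution_sharp_iff[OF LC K len' that])
    show "linear_connection M A (\<lambda>p v Y. LC p v Y + difference_tensor \<alpha> \<beta>s LC K p v (Y p))"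
      unfolding assms(5) by (rule linear_connection_modified[OF LC K len'])
    show "compatible M A F (\<lambda>p v Y. LC p v Y + difference_tensor \<alpha> \<beta>s LC K p v (Y p))"
      unfolding assms(5,7) by (rule compatible_modified[OF LC K len'])
  qed
  have "\<exists>K>0. \<forall>p\<in>topspace M. \<alpha> p (\<beta>s p) (\<beta>s p) = K\<^sup>2"
    if D: "linear_connection M A D" "compatible M A F D" for D
  proof -
    \<comment> \<open>The constant is the length of the dual field at a point where
      \<open>\<beta>\<close> does not vanish, which ensures that it is positive.\<close>
    obtain p v where p: "p \<in> topspace M" and v: "v \<in> tangent_space A p" and nz: "\<beta> p v \<noteq> 0"
      using assms(8) by blast
    have "\<beta>s p \<noteq> 0"
    proof
      assume "\<beta>s p = 0"
      then have "sharp A \<alpha> \<beta> p = 0" by (simp only: assms(5))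
      then show False using metric_sharp[OF p v] metric_zero_left[OF p v] nz by (simp only:)
    qed
    then have pos: "0 < \<alpha> p (\<beta>s p) (\<beta>s p)"
      unfolding assms(5) by (rule metric_pos[OF p sharp_tangent[OF p]])
    have "\<alpha> q (\<beta>s q) (\<beta>s q) = (sqrt (\<alpha> p (\<beta>s p) (\<beta>s p)))\<^sup>2" if "q \<in> topspace M" for q
      using sq_length_constant[OF D(1) D(2)[unfolded assms(7)] assms(2) p that] pos
      unfolding assms(5) by simp
    then show ?thesis using pos by (intro exI[of _ "sqrt (\<alpha> p (\<beta>s p) (\<beta>s p))"]) simp
  qed
  then have only_if: "\<exists>D. linear_connection M A D \<and> compatible M A F D \<Longrightarrow>
      \<exists>K>0. \<forall>p\<in>topspace M. \<alpha> p (\<beta>s p) (\<beta>s p) = K\<^sup>2"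
    by (elim exE conjE)
  have "\<exists>D. linear_connection M A D \<and> compatible M A F D"
    if "\<exists>K>0. \<forall>p\<in>topspace M. \<alpha> p (\<beta>s p) (\<beta>s p) = K\<^sup>2"
  proof -
    obtain K where "K > 0" "\<forall>p\<in>topspace M. \<alpha> p (\<beta>s p) (\<beta>s p) = K\<^sup>2" using \<open>\<exists>K>0. _\<close> by (elim exE conjE)
    from modified[OF this] show ?thesis by (intro exI) (elim conjE, rule conjI)
  qed
  with only_if have iff: "(\<exists>D. linear_connection M A D \<and> compatible M A F D) \<longleftrightarrow>
      (\<exists>K>0. \<forall>p\<in>topspace M. \<alpha> p (\<beta>s p) (\<beta>s p) = K\<^sup>2)"
    by (rule iffI)
  show ?thesis
    by (rule conjI[OF iff]) (rule allI, rule impI, rule impI, rule modified)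
qed

end
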